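(* Let $A$ be a finite associative conformal algebra and $(M,l_A,r_A)$ be a finite bimodule of $A$. Suppose that $A$ and $M$ are free as $\mathbb{C}[\partial]$-modules. Let $T\in Chom(M,A)$ and let $r_T\in A\otimes M^{\ast c}\subset(A\ltimes_{r_A^\ast,l_A^\ast}M^{\ast c})\otimes(A\ltimes_{r_A^\ast,l_A^\ast}M^{\ast c})$ be the element corresponding to $T$ under the isomorphism $Chom(M,A)\cong A\otimes M^{\ast c}$. Then $r=r_T-\tau r_T$ is an antisymmetric solution of the associative conformal Yang-Baxter equation in $A\ltimes_{r_A^\ast,l_A^\ast}M^{\ast c}$ if and only if $T_0=T_\lambda|_{\lambda=0}$ is an $\mathcal{O}$-operator associated with the bimodule $(M,l_A,r_A)$.
   Context: Everything is over $\mathbb{C}$. An associative conformal algebra is a $\mathbb{C}[\partial]$-module $A$ with a $\mathbb{C}$-bilinear map $A\times A\to A[\lambda]$, $(a,b)\mapsto a_\lambda b$, such that $(\partial a)_\lambda b=-\lambda a_\lambda b$, $a_\lambda(\partial b)=(\partial+\lambda)(a_\lambda b)$ and $(a_\lambda b)_{\lambda+\mu}c=a_\lambda(b_\mu c)$. Finite means finitely generated as a $\mathbb{C}[\partial]$-module. Convention: $\phi_{-\lambda-\partial}v$ means: write $\phi_\nu v=\sum_k\nu^kc_k$ and take $\sum_k(-\lambda-\partial)^kc_k$, $\partial$ acting on the $c_k$. $Chom(U,V)$: $\mathbb{C}$-linear maps $a_\lambda:U\to V[\lambda]$ with $a_\lambda(\partial u)=(\partial+\lambda)a_\lambda u$,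 a $\mathbb{C}[\partial]$-module via $(\partial a)_\lambda=-\lambda a_\lambda$; $Cend(V)=Chom(V,V)$; the conformal dual is $U^{\ast c}=Chom(U,\mathbb{C})$, $\mathbb{C}$ with $\partial=0$. Bimodule $(M,l_A,r_A)$ of $A$: a $\mathbb{C}[\partial]$-module $M$ with $\mathbb{C}[\partial]$-module homomorphisms $l_A,r_A:A\to Cend(M)$ such that $l_A(a_\lambda b)_{\lambda+\mu}v=l_A(a)_\lambda(l_A(b)_\mu v)$, $r_A(b)_{-\lambda-\mu-\partial}(r_A(a)_{-\lambda-\partial}v)=r_A(a_\mu b)_{-\lambda-\partial}v$, $l_A(a)_\lambda(r_A(b)_{-\mu-\partial}v)=r_A(b)_{-\lambda-\mu-\partial}(l_A(a)_\lambda v)$. For $M$ finite, $(M^{\ast c},r_A^\ast,l_A^\ast)$ is a bimodule of $A$, where $(l_A^\ast(a)_\lambda f)_\mu u=f_{\mu-\lambda}(l_A(a)_\lambda u)$ and $(r_A^\ast(a)_\lambda f)_\mu u=f_{\mu-\lambda}(r_A(a)_\lambda u)$. For a bimodule $(B,l,r)$ of $A$, the semi-direct product $A\ltimes_{l,r}B$ is the associative conformal algebra $A\oplus B$ with $(a+x)_\lambda(b+y)=a_\lambda b+l(a)_\lambda y+r(b)_{-\lambda-\partial}x$. The isomorphism of $\mathbb{C}[\partial]$-modules $M^{\ast c}\otimes A\cong Chom(M,A)$ is $\varphi(f\otimes a)_\lambda v=f_{\lambda+\partial^A}(v)a$ ($f_\nu(v)\in\mathbb{C}[\nu]$ evaluated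 at $\nu=\lambda+\partial$ and applied to $a\in A$); composing with the flip $M^{\ast c}\otimes A\cong A\otimes M^{\ast c}$ gives $Chom(M,A)\cong A\otimes M^{\ast c}$, $T\mapsto r_T$. An $\mathcal{O}$-operator associated with $(M,l_A,r_A)$ is a $\mathbb{C}[\partial]$-module homomorphism $T:M\to A$ with $T(u)_\lambda T(v)=T(l_A(T(u))_\lambda v)+T(r_A(T(v))_{-\lambda-\partial}u)$ for all $u,v\in M$. $\tau(x\otimes y)=y\otimes x$; $r$ is antisymmetric if $\tau r=-r$. For an associative conformal algebra $B$ and $r=\sum_ir_i\otimes l_i\in B\otimes B$, put $\partial^{\otimes^2}=\partial\otimes1+1\otimes\partial$, $\partial^{\otimes^3}=\partial\otimes1\otimes1+1\otimes\partial\otimes1+1\otimes1\otimes\partial$ and $$r\bullet r=\sum_{i,j}\Big(r_i\otimes r_j\otimes{l_i}_\mu l_j\big|_{\mu=\partial\otimes1\otimes1}-r_i\otimes{r_j}_\mu l_i\otimes l_j\big|_{\mu=-\partial^{\otimes^2}\otimes1}+{r_i}_\mu r_j\otimes l_i\otimes l_j\big|_{\mu=1\otimes\partial\otimes1}\Big),$$ where powers of $\mu$ are replaced by powers of the operator acting on the coefficients in $B^{\otimes3}$. The associative conformal Yang-Baxter equation in $B$ is $r\bullet r\equiv0\ \mathrm{mod}\ (\partial^{\otimes^3})$, i.e. $r\bullet r\in\partial^{\otimes^3}(B\otimes B\otimes B)$. *)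

theory Defs
  imports
    Complex_Main
    "HOL-Computational_Algebra.Polynomial"
    "HOL-Library.Poly_Mapping"
    "HOL-Library.Product_Plus"
    "HOL-Library.Function_Algebras"
begin

section \<open>Complex vector spaces and \<open>\<complex>[\<partial>]\<close>-modules\<close>

class complex_vector = ab_group_add +
  fixes scaleC :: "complex \<Rightarrow> 'a \<Rightarrow> 'a" (infixr \<open>*\<^sub>C\<close> 75)
  assumes scaleC_add_right: "c *\<^sub>C (x + y) = c *\<^sub>C x + c *\<^sub>C y"
    and scaleC_add_left: "(c + d) *\<^sub>C x = c *\<^sub>C x + d *\<^sub>C x"
    and scaleC_scaleC: "c *\<^sub>C (d *\<^sub>C x) = (c * d) *\<^sub>C x"
    and scaleC_one: "1 *\<^sub>C x = x"

global_interpretation cvec: vector_space "scaleC :: complex \<Rightarrow> 'a \<Rightarrow> 'a::complex_vector"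
  by standard (rule scaleC_add_right scaleC_add_left scaleC_scaleC scaleC_one)+

abbreviation clinear :: "('a::complex_vector \<Rightarrow> 'b::complex_vector) \<Rightarrow> bool" where
  "clinear \<equiv> Vector_Spaces.linear scaleC scaleC"

lemma clinearI:
  assumes "\<And>x y. f (x + y) = f x + f y" "\<And>c x. f (c *\<^sub>C x) = c *\<^sub>C f x"
  shows "clinear f"
  by unfold_locales (auto simp: assms)

lemma clinear_iff:
  "clinear f \<longleftrightarrow> (\<forall>x y. f (x + y) = f x + f y) \<and> (\<forall>c x. f (c *\<^sub>C x) = c *\<^sub>C f x)"
  by (meson clinearI Vector_Spaces.linear.axioms(3) module_hom.add module_hom.scale)

lemma clinearD:
  assumes "clinear f"
  shows "f (x + y) = f x + f y" "f (c *\<^sub>C x) = c *\<^sub>C f x" "f 0 = 0"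
    "f (- x) = - f x" "f (x - y) = f x - f y" "f (sum g S) = (\<Sum>s\<in>S. f (g s))"
proof -
  interpret Vector_Spaces.linear scaleC scaleC f by (rule assms)
  show "f (x + y) = f x + f y" "f (c *\<^sub>C x) = c *\<^sub>C f x" "f 0 = 0"
    "f (- x) = - f x" "f (x - y) = f x - f y" "f (sum g S) = (\<Sum>s\<in>S. f (g s))"
    by (rule add scale zero neg diff sum)+
qed

text \<open>A \<open>\<complex>[\<partial>]\<close>-module is a complex vector space with a linear endomorphism \<open>\<partial>\<close>; the action of
  polynomials in \<open>\<partial>\<close> is \<open>dact\<close> below.\<close>

class cd_module = complex_vector +
  fixes cpartial :: "'a \<Rightarrow> 'a" (\<open>\<partial>\<close>)
  assumes partial_add: "\<partial> (x + y) = \<partial> x + \<partial> y"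
    and partial_scaleC: "\<partial> (c *\<^sub>C x) = c *\<^sub>C \<partial> x"

lemma clinear_partial: "clinear \<partial>"
  by (rule clinearI) (rule partial_add partial_scaleC)+

text \<open>Substitution of an operator for the indeterminate of a polynomial with (transformed)
  coefficients: \<open>\<Sum>\<^sub>k \<nu>\<^sup>k c\<^sub>k\<close> is sent to \<open>\<Sum>\<^sub>k X\<^sup>k (f c\<^sub>k)\<close>.\<close>

definition psubst :: "('b::comm_monoid_add \<Rightarrow> 'b) \<Rightarrow> ('a::zero \<Rightarrow> 'b) \<Rightarrow> 'a poly \<Rightarrow> 'b" where
  "psubst X f p = (\<Sum>k\<le>degree p. (X ^^ k) (f (coeff p k)))"

definition dact :: "complex poly \<Rightarrow> 'a \<Rightarrow> 'a::cd_module" where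
  "dact p v = psubst \<partial> (\<lambda>c. c *\<^sub>C v) p"

definition cd_finite :: "'a::cd_module itself \<Rightarrow> bool" where
  "cd_finite _ \<longleftrightarrow> (\<exists>S :: 'a set. finite S \<and> module.span dact S = UNIV)"

definition cd_free :: "'a::cd_module itself \<Rightarrow> bool" where
  "cd_free _ \<longleftrightarrow> (\<exists>S :: 'a set. \<not> module.dependent dact S \<and> module.span dact S = UNIV)"

definition cd_hom :: "('a::cd_module \<Rightarrow> 'b::cd_module) \<Rightarrow> bool" where
  "cd_hom f \<longleftrightarrow> clinear f \<and> (\<forall>x. f (\<partial> x) = \<partial> (f x))"

lemma psubst_cong_bound:
  assumes "\<And>k. (X ^^ k) 0 = 0" "f 0 = 0" "degree p \<le> n"
  shows "psubst X f p = (\<Sum>k\<le>n. (X ^^ k) (f (coeff p k)))"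
  unfolding psubst_def
  by (rule sum.mono_neutral_left) (use assms in \<open>auto simp: coeff_eq_0\<close>)

lemma funpow_clinear:
  fixes X :: "'a::complex_vector \<Rightarrow> 'a"
  shows "clinear X \<Longrightarrow> clinear (X ^^ k)"
  by (induction k) (auto simp: clinear_iff)

lemma psubst_0: "f 0 = 0 \<Longrightarrow> psubst X f 0 = 0"
  by (simp add: psubst_def)

lemma psubst_pCons:
  assumes X: "clinear X" and f: "f 0 = 0"
  shows "psubst X f (pCons a p) = f a + X (psubst X f p)"
proof -
  have X0: "(X ^^ k) 0 = 0" for k using funpow_clinear[OF X] by (rule clinearD)
  have "psubst X f (pCons a p) = (\<Sum>k\<le>Suc (degree p). (X ^^ k) (f (coeff (pCons a p) k)))"
    by (rule psubst_cong_bound) (auto simp: X0 f degree_pCons_le)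
  also have "\<dots> = f a + (\<Sum>k\<le>degree p. (X ^^ Suc k) (f (coeff p k)))"
    by (subst sum.atMost_Suc_shift) simp
  also have "(\<Sum>k\<le>degree p. (X ^^ Suc k) (f (coeff p k))) = X (psubst X f p)"
    unfolding psubst_def by (simp add: clinearD(6)[OF X])
  finally show ?thesis .
qed

lemma psubst_add:
  assumes X: "clinear X" and f: "f 0 = 0" "\<And>x y. f (x + y) = f x + f y"
  shows "psubst X f (p + q) = psubst X f p + psubst X f q"
proof (induction p q rule: poly_induct2)
  case 0 show ?case by (simp add: psubst_0 f)
next
  case (pCons a p b q)
  have *: "psubst X f (pCons c r) = f c + X (psubst X f r)" for c r
    by (rule psubst_pCons) (rule X f(1))+
  show ?case by (simp add: * pCons f clinearD(1)[OF X] ac_simps)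
qed

lemma psubst_fun_add:
  assumes X: "clinear X" and "f 0 = 0" "g 0 = 0"
  shows "psubst X (\<lambda>c. f c + g c) p = psubst X f p + psubst X g p"
  by (simp add: psubst_def clinearD(1)[OF funpow_clinear[OF X]] sum.distrib)

lemma psubst_fun_scaleC:
  assumes X: "clinear X"
  shows "psubst X (\<lambda>c. d *\<^sub>C f c) p = d *\<^sub>C psubst X f p"
  by (simp add: psubst_def clinearD(2)[OF funpow_clinear[OF X]] cvec.scale_sum_right)

lemma psubst_comm:
  assumes X: "clinear X" "clinear Y" and Z: "clinear Z" "\<And>x. Z (X x) = Y (Z x)" and f: "f 0 = 0"
  shows "Z (psubst X f p) = psubst Y (\<lambda>c. Z (f c)) p"
  by (induction p)
    (simp_all add: psubst_0 psubst_pCons X f clinearD(1,3)[OF Z(1)] Z(2))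

section \<open>Instances\<close>

instantiation complex :: cd_module
begin
definition scaleC_complex :: "complex \<Rightarrow> complex \<Rightarrow> complex" where "scaleC_complex = (*)"
definition cpartial_complex :: "complex \<Rightarrow> complex" where "cpartial_complex _ = 0"
instance by standard (auto simp: scaleC_complex_def cpartial_complex_def algebra_simps)
end

instantiation prod :: (complex_vector, complex_vector) complex_vector
begin
definition scaleC_prod :: "complex \<Rightarrow> 'a \<times> 'b \<Rightarrow> 'a \<times> 'b" where
  "scaleC_prod c p = (c *\<^sub>C fst p, c *\<^sub>C snd p)"
instance by standard (auto simp: scaleC_prod_def algebra_simps)
end

instantiation prod :: (cd_module, cd_module) cd_module
begin
definition cpartial_prod :: "'a \<times> 'b \<Rightarrow> 'a \<times> 'b" where
  "cpartial_prod p = (\<partial> (fst p), \<partial> (snd p))"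
instance by standard (auto simp: scaleC_prod_def cpartial_prod_def partial_add partial_scaleC)
end

text \<open>\<open>V[\<lambda>]\<close> is \<^typ>\<open>'v poly\<close> with \<open>\<complex>\<close> and \<open>\<partial>\<close> acting on coefficients; \<open>V[\<lambda>, \<mu>]\<close> is
  \<^typ>\<open>'v poly poly\<close>, with \<open>\<lambda>\<close> the inner and \<open>\<mu>\<close> the outer indeterminate.\<close>

instantiation poly :: (complex_vector) complex_vector
begin
definition scaleC_poly :: "complex \<Rightarrow> 'a poly \<Rightarrow> 'a poly" where
  "scaleC_poly c = map_poly (scaleC c)"
instance
  by standard (auto simp: scaleC_poly_def poly_eq_iff coeff_map_poly algebra_simps)
end

instantiation poly :: (cd_module) cd_module
begin
definition cpartial_poly :: "'a poly \<Rightarrow> 'a poly" where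
  "cpartial_poly = map_poly \<partial>"
instance
  by standard (auto simp: scaleC_poly_def cpartial_poly_def poly_eq_iff coeff_map_poly
      clinearD[OF clinear_partial])
end

lemma coeff_scaleC [simp]: "coeff (c *\<^sub>C p) k = c *\<^sub>C coeff p k"
  by (simp add: scaleC_poly_def coeff_map_poly)

lemma coeff_partial [simp]: "coeff (\<partial> p) k = \<partial> (coeff p k)"
  by (simp add: cpartial_poly_def coeff_map_poly clinearD[OF clinear_partial])

lemma partial_complex_poly: "\<partial> (p :: complex poly) = 0"
  by (simp add: poly_eq_iff cpartial_complex_def)

text \<open>Multiplication by the (outer) indeterminate, and by the inner one of \<open>V[\<lambda>, \<mu>]\<close>.\<close>

abbreviation indet :: "'a::zero poly \<Rightarrow> 'a poly" where "indet \<equiv> pCons 0"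

abbreviation lam :: "'a::zero poly poly \<Rightarrow> 'a poly poly" where "lam \<equiv> map_poly indet"
abbreviation mu :: "'a::zero poly poly \<Rightarrow> 'a poly poly" where "mu \<equiv> indet"

text \<open>For \<open>p \<in> V[\<nu>]\<close>: the substitution \<open>\<nu> = X\<close> with values in \<open>V[\<lambda>]\<close> and in \<open>V[\<lambda>, \<mu>]\<close>; for
  instance \<open>\<phi>\<^bsub>-\<lambda>-\<partial>\<^esub> v\<close> is \<open>at1 (- indet - \<partial>) (\<phi> v)\<close>.\<close>

abbreviation at1 :: "('a poly \<Rightarrow> 'a poly) \<Rightarrow> 'a::comm_monoid_add poly \<Rightarrow> 'a poly" where
  "at1 X \<equiv> psubst X (\<lambda>c. [:c:])"

abbreviation at2 :: "('a poly poly \<Rightarrow> 'a poly poly) \<Rightarrow> 'a::comm_monoid_add poly \<Rightarrow> 'a poly poly" where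
  "at2 X \<equiv> psubst X (\<lambda>c. [:[:c:]:])"

lemma clinear_indet: "clinear (indet :: 'a::complex_vector poly \<Rightarrow> 'a poly)"
  by (rule clinearI) (auto simp: poly_eq_iff coeff_pCons split: nat.splits)

lemma clinear_map_poly: "clinear f \<Longrightarrow> clinear (map_poly f)"
  by (rule clinearI) (auto simp: poly_eq_iff coeff_map_poly clinearD)

lemma clinear_lam: "clinear (lam :: 'a::complex_vector poly poly \<Rightarrow> 'a poly poly)"
  by (rule clinear_map_poly clinear_indet)+

lemma clinear_ops:
  "clinear f \<Longrightarrow> clinear g \<Longrightarrow> clinear (f + g)"
  "clinear f \<Longrightarrow> clinear g \<Longrightarrow> clinear (f - g)"
  "clinear f \<Longrightarrow> clinear (- f)"
  by (auto simp: clinear_iff algebra_simps)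

lemma scaleC_pCons: "c *\<^sub>C pCons a p = pCons (c *\<^sub>C a) (c *\<^sub>C p)"
  by (auto simp: poly_eq_iff coeff_pCons split: nat.splits)

lemma clinear_psubst:
  assumes "clinear X" "clinear f"
  shows "clinear (psubst X f)"
proof (rule clinearI)
  show add: "psubst X f (p + q) = psubst X f p + psubst X f q" for p q
    by (rule psubst_add) (use assms in \<open>auto simp: clinearD\<close>)
  show "psubst X f (c *\<^sub>C p) = c *\<^sub>C psubst X f p" for c p
  proof (induction p)
    case (pCons a p)
    show ?case
      by (simp add: scaleC_pCons psubst_pCons[OF assms(1)] clinearD[OF assms(2)] clinearD[OF assms(1)]
          pCons algebra_simps)
  qed (use assms in \<open>auto simp: psubst_0 clinearD\<close>)
qed

lemma partial_indet: "\<partial> (indet p) = indet (\<partial> (p :: 'a::cd_module poly))"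
  by (auto simp: poly_eq_iff coeff_pCons clinearD[OF clinear_partial] split: nat.splits)

lemma module_dact: "module (dact :: complex poly \<Rightarrow> 'a::cd_module \<Rightarrow> 'a)"
proof
  note [simp] = psubst_pCons[OF clinear_partial] psubst_0
  fix p q :: "complex poly" and x y :: 'a
  show "dact p (x + y) = dact p x + dact p y"
    unfolding dact_def cvec.scale_right_distrib
    by (rule psubst_fun_add[OF clinear_partial]) auto
  show add: "dact (p + q) x = dact p x + dact q x" for p q x
    unfolding dact_def
    by (rule psubst_add[OF clinear_partial]) (auto simp: algebra_simps)
  have smult: "dact (smult c q) x = c *\<^sub>C dact q x" for c q
    by (induction q) (auto simp: dact_def algebra_simps clinearD[OF clinear_partial])
  show "dact p (dact q x) = dact (p * q) x"
  proof (induction p)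
    case (pCons a p)
    have "dact (pCons a p) (dact q x) = a *\<^sub>C dact q x + \<partial> (dact p (dact q x))"
      by (simp add: dact_def)
    also have "\<dots> = dact (smult a q) x + dact (pCons 0 (p * q)) x"
      by (simp add: pCons smult) (simp add: dact_def)
    also have "\<dots> = dact (pCons a p * q) x"
      by (simp only: add[symmetric] mult_pCons_left)
    finally show ?case .
  qed (simp add: dact_def)
  show "dact 1 x = x"
    by (simp add: dact_def one_pCons clinearD[OF clinear_partial])
qed

global_interpretation cd: module "dact :: complex poly \<Rightarrow> 'a \<Rightarrow> 'a::cd_module"
  by (rule module_dact)

section \<open>Conformal homomorphisms\<close>

text \<open>\<open>a \<cdot> u\<close> is \<open>a\<^sub>\<lambda> u\<close>.\<close>

typedef (overloaded) ('u::cd_module, 'v::cd_module) chom =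
  "{a :: 'u \<Rightarrow> 'v poly. clinear a \<and> (\<forall>u. a (\<partial> u) = (\<partial> + indet) (a u))}"
  morphisms capp Abs_chom
proof
  show "(\<lambda>_. 0) \<in> {a :: 'u \<Rightarrow> 'v poly. clinear a \<and> (\<forall>u. a (\<partial> u) = (\<partial> + indet) (a u))}"
    by (auto simp: clinear_iff clinearD[OF clinear_partial])
qed

notation capp (infixl \<open>\<cdot>\<close> 80)

setup_lifting type_definition_chom

type_synonym 'v cend = "('v, 'v) chom"
type_synonym 'u cdual = "('u, complex) chom"

lemma clinear_capp: "clinear (capp a)"
  using capp[of a] by simp

lemma capp_partial: "a \<cdot> \<partial> u = \<partial> (a \<cdot> u) + indet (a \<cdot> u)"
  using capp[of a] by simp

instantiation chom :: (cd_module, cd_module) cd_module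
begin
lift_definition zero_chom :: "('a, 'b) chom" is "\<lambda>_. 0"
  by (auto simp: clinear_iff clinearD[OF clinear_partial])
lift_definition plus_chom :: "('a, 'b) chom \<Rightarrow> ('a, 'b) chom \<Rightarrow> ('a, 'b) chom" is "\<lambda>a b u. a u + b u"
  by (auto simp: clinear_iff partial_add algebra_simps)
lift_definition uminus_chom :: "('a, 'b) chom \<Rightarrow> ('a, 'b) chom" is "\<lambda>a u. - a u"
  by (auto simp: clinear_iff clinearD[OF clinear_partial] algebra_simps)
lift_definition minus_chom :: "('a, 'b) chom \<Rightarrow> ('a, 'b) chom \<Rightarrow> ('a, 'b) chom" is "\<lambda>a b u. a u - b u"
  by (auto simp: clinear_iff clinearD[OF clinear_partial] algebra_simps)
lift_definition scaleC_chom :: "complex \<Rightarrow> ('a, 'b) chom \<Rightarrow> ('a, 'b) chom" is "\<lambda>c a u. c *\<^sub>C a u"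
  by (auto simp: clinear_iff clinearD[OF clinear_partial] scaleC_pCons algebra_simps)
lift_definition cpartial_chom :: "('a, 'b) chom \<Rightarrow> ('a, 'b) chom" is "\<lambda>a u. - indet (a u)"
  by (auto simp: clinear_iff clinearD[OF clinear_partial] scaleC_pCons partial_indet
      algebra_simps)
instance
  by (standard; transfer)
    (auto simp: fun_eq_iff algebra_simps scaleC_pCons)
end

section \<open>Associative conformal algebras, bimodules and O-operators\<close>

text \<open>\<open>psubst lam\<close> and \<open>psubst mu\<close> extend a map on coefficients to polynomials in \<open>\<lambda>\<close>, respectively
  \<open>\<mu>\<close>: if \<open>a\<^sub>\<lambda> b = \<Sum>\<^sub>k \<lambda>\<^sup>k e\<^sub>k\<close>, then the left-hand side of \<open>assoc\<close> is \<open>\<Sum>\<^sub>k \<lambda>\<^sup>k (e\<^sub>k)\<^bsub>\<lambda>+\<mu>\<^esub> c\<close>.\<close>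

locale assoc_conformal_algebra =
  fixes pr :: "'a::cd_module \<Rightarrow> 'a \<Rightarrow> 'a poly"
  assumes linear_right: "clinear (pr a)"
    and linear_left: "clinear (\<lambda>a. pr a b)"
    and sesqui_left: "pr (\<partial> a) b = - indet (pr a b)"
    and sesqui_right: "pr a (\<partial> b) = (\<partial> + indet) (pr a b)"
    and assoc: "psubst lam (\<lambda>e. at2 (lam + mu) (pr e c)) (pr a b)
      = psubst mu (\<lambda>d. at2 lam (pr a d)) (pr b c)"

locale conformal_bimodule =
  fixes pr :: "'a::cd_module \<Rightarrow> 'a \<Rightarrow> 'a poly"
    and l r :: "'a \<Rightarrow> 'm::cd_module cend"
  assumes hom_l: "cd_hom l"
    and hom_r: "cd_hom r"
    and left_left: "psubst lam (\<lambda>e. at2 (lam + mu) (l e \<cdot> v)) (pr a b)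
      = psubst mu (\<lambda>w. at2 lam (l a \<cdot> w)) (l b \<cdot> v)"
    and right_right:
      "psubst lam (\<lambda>w. at2 (- lam - mu - \<partial>) (r b \<cdot> w)) (at1 (- indet - \<partial>) (r a \<cdot> v))
      = psubst mu (\<lambda>e. at2 (- lam - \<partial>) (r e \<cdot> v)) (pr a b)"
    and left_right:
      "psubst mu (\<lambda>w. at2 lam (l a \<cdot> w)) (at1 (- indet - \<partial>) (r b \<cdot> v))
      = psubst lam (\<lambda>w. at2 (- lam - mu - \<partial>) (r b \<cdot> w)) (l a \<cdot> v)"

definition o_operator ::
    "('a::cd_module \<Rightarrow> 'a \<Rightarrow> 'a poly) \<Rightarrow> ('a \<Rightarrow> 'm::cd_module cend) \<Rightarrow> ('a \<Rightarrow> 'm cend) \<Rightarrow> ('m \<Rightarrow> 'a) \<Rightarrow> bool" where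
  "o_operator pr l r T \<longleftrightarrow> cd_hom T \<and>
    (\<forall>u v. pr (T u) (T v)
      = map_poly T (l (T u) \<cdot> v) + map_poly T (at1 (- indet - \<partial>) (r (T v) \<cdot> u)))"

definition semidirect ::
    "('a::cd_module \<Rightarrow> 'a \<Rightarrow> 'a poly) \<Rightarrow> ('a \<Rightarrow> 'b::cd_module cend) \<Rightarrow> ('a \<Rightarrow> 'b cend)
      \<Rightarrow> 'a \<times> 'b \<Rightarrow> 'a \<times> 'b \<Rightarrow> ('a \<times> 'b) poly" where
  "semidirect pr l r = (\<lambda>(a, x) (b, y).
     map_poly (\<lambda>c. (c, 0)) (pr a b)
     + map_poly (\<lambda>z. (0, z)) (l a \<cdot> y + at1 (- indet - \<partial>) (r b \<cdot> x)))"

text \<open>The contragredient \<open>x\<^sup>*\<close> of \<open>x \<in> Cend(M)\<close>, determined by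
  \<open>(x\<^sup>*\<^sub>\<lambda> f)\<^sub>\<mu> u = f\<^bsub>\<mu>-\<lambda>\<^esub> (x\<^sub>\<lambda> u)\<close>; for finite \<open>M\<close> existence and uniqueness are shown below.\<close>

definition is_cdual_map :: "'m::cd_module cend \<Rightarrow> 'm cdual cend \<Rightarrow> bool" where
  "is_cdual_map x y \<longleftrightarrow> (\<forall>f u.
     psubst lam (\<lambda>g. at2 mu (g \<cdot> u)) (y \<cdot> f) = psubst lam (\<lambda>w. at2 (mu - lam) (f \<cdot> w)) (x \<cdot> u))"

definition cdual_rep :: "('a \<Rightarrow> 'm::cd_module cend) \<Rightarrow> 'a \<Rightarrow> 'm cdual cend" where
  "cdual_rep l a = (THE y. is_cdual_map (l a) y)"

lemma coeff_at2_mu: "coeff (at2 mu p) j = [:coeff (p :: 'a::complex_vector poly) j:]"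
  by (induction p arbitrary: j)
    (simp_all add: psubst_0 psubst_pCons[OF clinear_indet] coeff_pCons split: nat.splits)

lemma coeff_psubst_lam:
  fixes P :: "'m::cd_module cdual poly"
  shows "coeff (coeff (psubst lam (\<lambda>g. at2 mu (g \<cdot> u)) P) j) k = coeff (coeff P k \<cdot> u) j"
proof (induction P arbitrary: k)
  case 0
  show ?case by (simp add: psubst_0 zero_chom.rep_eq)
next
  case (pCons g P)
  have "psubst lam (\<lambda>g. at2 mu (g \<cdot> u)) (pCons g P)
      = at2 mu (g \<cdot> u) + lam (psubst lam (\<lambda>g. at2 mu (g \<cdot> u)) P)"
    by (rule psubst_pCons[OF clinear_lam]) (simp add: psubst_0 zero_chom.rep_eq)
  then show ?case
    by (simp add: coeff_at2_mu coeff_map_poly coeff_pCons pCons split: nat.splits)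
qed

lemma cdual_map_unique:
  assumes "is_cdual_map x y" "is_cdual_map x z"
  shows "y = z"
proof -
  have "coeff (coeff (y \<cdot> f) k \<cdot> u) j = coeff (coeff (z \<cdot> f) k \<cdot> u) j" for f k u j
    using assms unfolding is_cdual_map_def by (metis coeff_psubst_lam)
  then show ?thesis
    by (auto simp: capp_inject[symmetric] fun_eq_iff poly_eq_iff)
qed

lemma cdual_map_exists:
  fixes x :: "'m::cd_module cend"
  assumes "cd_finite TYPE('m)"
  shows "\<exists>y. is_cdual_map x y"
proof -
  define F where "F f w = at2 (mu - lam) (f \<cdot> w)" for f :: "'m cdual" and w
  define R where "R f u = psubst lam (F f) (x \<cdot> u)" for f u
  define G where "G f k u = map_poly (\<lambda>q. coeff q k) (R f u)" for f k u
  have mlin: "clinear (mu - lam :: complex poly poly \<Rightarrow> _)"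
    by (intro clinear_ops clinear_indet clinear_lam)
  have emb: "clinear (\<lambda>c::complex. [:[:c:]:])"
    by (rule clinearI) (auto simp: scaleC_pCons)
  note at2_lin = clinear_psubst[OF mlin emb]
  have F_lin: "clinear (F f)" for f
    using at2_lin clinear_capp[of f] by (auto simp: clinear_iff F_def)
  have F_add: "F (f + g) w = F f w + F g w" and F_scale: "F (c *\<^sub>C f) w = c *\<^sub>C F f w" for f g c w
    using at2_lin by (auto simp: clinear_iff F_def plus_chom.rep_eq scaleC_chom.rep_eq)
  have F_partial: "F f (\<partial> w) = (mu - lam) (F f w)" for f w
    by (simp add: F_def capp_partial partial_complex_poly psubst_pCons[OF mlin])
  have F_partial': "F (\<partial> f) w = - (mu - lam) (F f w)" for f w
  proof -
    have "F (\<partial> f) w = - at2 (mu - lam) (indet (f \<cdot> w))"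
      unfolding F_def cpartial_chom.rep_eq by (rule clinearD(4)[OF at2_lin])
    then show ?thesis by (simp add: F_def psubst_pCons[OF mlin])
  qed
  have comm: "lam ((mu - lam) p) = (mu - lam) (lam p)" for p :: "complex poly poly"
    by (simp add: clinearD[OF clinear_lam])
       (simp add: poly_eq_iff coeff_map_poly coeff_pCons split: nat.splits)
  have comm': "lam ((lam - mu) p) = (lam - mu) (lam p)" for p :: "complex poly poly"
    by (simp add: clinearD[OF clinear_lam])
       (simp add: poly_eq_iff coeff_map_poly coeff_pCons split: nat.splits)
  note psF = clinear_psubst[OF clinear_lam F_lin]
  have psF_partial: "psubst lam (F f) (\<partial> p) = (mu - lam) (psubst lam (F f) p)" for f p
  proof (induction p)
    case 0
    show ?case by (simp add: psubst_0 clinearD[OF F_lin] clinearD[OF clinear_partial])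
  next
    case (pCons a p)
    have "\<partial> (pCons a p) = pCons (\<partial> a) (\<partial> p)"
      by (auto simp: poly_eq_iff coeff_pCons split: nat.splits)
    then show ?case
      by (simp add: psubst_pCons[OF clinear_lam] clinearD(3)[OF F_lin] F_partial pCons comm
          clinearD(1)[OF mlin] del: fun_diff_def minus_apply)
  qed
  have R_lin: "clinear (R f)" for f
    using psF clinear_capp[of x] by (auto simp: clinear_iff R_def)
  have R_partial: "R f (\<partial> u) = mu (R f u)" for f u
    by (simp add: R_def capp_partial clinearD(1)[OF psF] psF_partial psubst_pCons[OF clinear_lam]
        clinearD(3)[OF F_lin])
  have R_add: "R (f + g) u = R f u + R g u" for f g u
    unfolding R_def F_add
    by (rule psubst_fun_add[OF clinear_lam]) (rule clinearD(3)[OF F_lin])+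
  have R_scale: "R (c *\<^sub>C f) u = c *\<^sub>C R f u" for c f u
    unfolding R_def F_scale by (rule psubst_fun_scaleC[OF clinear_lam])
  have R_partial': "R (\<partial> f) u = lam (R f u) - mu (R f u)" for f u
  proof -
    have "(- (mu - lam)) (psubst lam (F f) (x \<cdot> u))
        = psubst lam (\<lambda>w. (- (mu - lam)) (F f w)) (x \<cdot> u)"
      by (rule psubst_comm[OF clinear_lam clinear_lam clinear_ops(3)[OF mlin]])
        (auto simp: clinearD(3)[OF F_lin] clinearD(4)[OF clinear_lam] comm comm' simp del: minus_apply)
    moreover have "F (\<partial> f) = (\<lambda>w. (- (mu - lam)) (F f w))"
      by (simp add: fun_eq_iff F_partial')
    ultimately show ?thesis by (simp add: R_def)
  qed
  have coeff_G: "coeff (G f k u) j = coeff (coeff (R f u) j) k" for f k u j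
    by (simp add: G_def coeff_map_poly)
  have G_lin: "clinear (G f k)" for f k
    using R_lin[of f] by (auto simp: clinear_iff poly_eq_iff coeff_G)
  have G_partial: "G f k (\<partial> u) = (\<partial> + indet) (G f k u)" for f k u
    by (simp add: partial_complex_poly poly_eq_iff coeff_G R_partial coeff_pCons split: nat.splits)
  define H where "H f k = Abs_chom (G f k)" for f k
  have H: "H f k \<cdot> u = G f k u" for f k u
    unfolding H_def using G_lin G_partial by (subst Abs_chom_inverse) auto
  have fin: "\<exists>N. \<forall>k>N. H f k = 0" for f
  proof -
    obtain S :: "'m set" where S: "finite S" "cd.span S = UNIV"
      using assms by (auto simp: cd_finite_def)
    have "\<exists>N. \<forall>k>N. G f k s = 0" for s
    proof -
      have "\<forall>k>Max ((\<lambda>j. degree (coeff (R f s) j)) ` {..degree (R f s)}). G f k s = 0"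
      proof (intro allI impI)
        fix k assume k: "k > Max ((\<lambda>j. degree (coeff (R f s) j)) ` {..degree (R f s)})"
        have "coeff (coeff (R f s) j) k = 0" for j
        proof (cases "j \<le> degree (R f s)")
          case True
          with k have "degree (coeff (R f s) j) < k" by auto
          then show ?thesis by (rule coeff_eq_0)
        qed (simp add: coeff_eq_0)
        then show "G f k s = 0" by (simp add: poly_eq_iff coeff_G)
      qed
      then show ?thesis by blast
    qed
    then obtain N where N: "\<And>s k. k > N s \<Longrightarrow> G f k s = 0" by metis
    define M where "M = Max (insert 0 (N ` S))"
    have "cd.subspace {u. \<forall>k>M. G f k u = 0}" (is "cd.subspace ?V")
    proof (rule cd.subspaceI)
      fix p u assume u: "u \<in> ?V"
      have "G f k (dact p u) = 0" if "k > M" for k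
        using u that
        by (induction p)
          (auto simp: dact_def psubst_0 psubst_pCons[OF clinear_partial] clinearD[OF G_lin]
            G_partial partial_complex_poly)
      then show "dact p u \<in> ?V" by simp
    qed (auto simp: clinearD[OF G_lin])
    moreover have "S \<subseteq> ?V"
    proof
      fix s assume "s \<in> S"
      then have "N s \<le> M" using S(1) by (auto simp: M_def)
      then show "s \<in> ?V" using N by auto
    qed
    ultimately have "?V = UNIV"
      using S(2) cd.span_minimal[of S ?V] by auto
    then have "\<forall>k>M. H f k = 0"
      by (auto simp: capp_inject[symmetric] fun_eq_iff H zero_chom.rep_eq)
    then show ?thesis by blast
  qed
  define P where "P f = Abs_poly (H f)" for f
  have coeff_P: "coeff (P f) k = H f k" for f k
  proof -
    obtain N where "\<forall>k>N. H f k = 0" using fin by blast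
    then show ?thesis
      unfolding P_def by (subst coeff_Abs_poly[of N]) auto
  qed
  have "P f = Q" if "\<And>k u. G f k u = coeff Q k \<cdot> u" for f Q
    using that by (auto simp: poly_eq_iff coeff_P capp_inject[symmetric] fun_eq_iff H)
  note PI = this
  have "clinear P"
    by (rule clinearI; rule PI)
      (auto simp: plus_chom.rep_eq scaleC_chom.rep_eq coeff_P H poly_eq_iff coeff_G R_add R_scale)
  moreover have "P (\<partial> f) = (\<partial> + indet) (P f)" for f
  proof (rule PI)
    fix k u
    show "G (\<partial> f) k u = coeff ((\<partial> + indet) (P f)) k \<cdot> u"
      by (auto simp: poly_eq_iff coeff_G R_partial' coeff_map_poly coeff_pCons coeff_P H
          plus_chom.rep_eq cpartial_chom.rep_eq zero_chom.rep_eq split: nat.splits)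
  qed
  ultimately have "Abs_chom P \<cdot> f = P f" for f
    by (subst Abs_chom_inverse) auto
  moreover have "R f u = psubst lam (\<lambda>w. at2 (mu - lam) (f \<cdot> w)) (x \<cdot> u)" for f u
    by (simp add: R_def F_def[abs_def])
  ultimately have "is_cdual_map x (Abs_chom P)"
    unfolding is_cdual_map_def
    by (auto simp: poly_eq_iff coeff_psubst_lam coeff_P H coeff_G)
  then show ?thesis ..
qed

lemma cdual_rep:
  fixes l :: "'a \<Rightarrow> 'm::cd_module cend"
  assumes "cd_finite TYPE('m)"
  shows "is_cdual_map (l a) (cdual_rep l a)"
  unfolding cdual_rep_def
  by (rule theI') (use cdual_map_exists[OF assms] cdual_map_unique in blast)

section \<open>Tensor products over \<open>\<complex>\<close>\<close>

instantiation poly_mapping :: (type, complex_vector) complex_vector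
begin
lift_definition scaleC_poly_mapping :: "complex \<Rightarrow> ('a \<Rightarrow>\<^sub>0 'b) \<Rightarrow> ('a \<Rightarrow>\<^sub>0 'b)" is
  "\<lambda>c f x. c *\<^sub>C f x"
  by (erule rev_finite_subset) auto
instance
  by (standard; transfer) (auto simp: fun_eq_iff algebra_simps)
end

abbreviation pure :: "'u \<Rightarrow> 'v \<Rightarrow> ('u \<times> 'v) \<Rightarrow>\<^sub>0 complex" where
  "pure u v \<equiv> Poly_Mapping.single (u, v) 1"

definition tensor_relations :: "(('u::complex_vector \<times> 'v::complex_vector) \<Rightarrow>\<^sub>0 complex) set" where
  "tensor_relations =
     {pure (u + u') v - pure u v - pure u' v | u u' v. True}
   \<union> {pure u (v + v') - pure u v - pure u v' | u v v'. True}
   \<union> {pure (c *\<^sub>C u) v - c *\<^sub>C pure u v | c u v. True}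
   \<union> {pure u (c *\<^sub>C v) - c *\<^sub>C pure u v | c u v. True}"

definition tensor_eq where
  "tensor_eq p q \<longleftrightarrow> p - q \<in> cvec.span tensor_relations"

quotient_type (overloaded) ('u, 'v) tensor =
  "('u::complex_vector \<times> 'v::complex_vector) \<Rightarrow>\<^sub>0 complex" / tensor_eq
proof (rule equivpI)
  show "reflp (tensor_eq :: ('u \<times> 'v \<Rightarrow>\<^sub>0 complex) \<Rightarrow> _)"
    by (auto simp: reflp_def tensor_eq_def cvec.span_zero)
  show "symp (tensor_eq :: ('u \<times> 'v \<Rightarrow>\<^sub>0 complex) \<Rightarrow> _)"
    unfolding symp_def tensor_eq_def by (auto dest: cvec.span_neg)
  show "transp (tensor_eq :: ('u \<times> 'v \<Rightarrow>\<^sub>0 complex) \<Rightarrow> _)"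
    unfolding transp_def tensor_eq_def by (auto dest: cvec.span_add)
qed

lemma tensor_eq_refl [simp]: "tensor_eq p p"
  by (simp add: tensor_eq_def cvec.span_zero)

instantiation tensor :: (complex_vector, complex_vector) complex_vector
begin
lift_definition zero_tensor :: "('a, 'b) tensor" is 0 .
lift_definition plus_tensor :: "('a, 'b) tensor \<Rightarrow> ('a, 'b) tensor \<Rightarrow> ('a, 'b) tensor" is "(+)"
  unfolding tensor_eq_def add_diff_add by (rule cvec.span_add)
lift_definition uminus_tensor :: "('a, 'b) tensor \<Rightarrow> ('a, 'b) tensor" is uminus
  unfolding tensor_eq_def minus_diff_minus by (rule cvec.span_neg)
lift_definition minus_tensor :: "('a, 'b) tensor \<Rightarrow> ('a, 'b) tensor \<Rightarrow> ('a, 'b) tensor" is "(-)"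
  unfolding tensor_eq_def by (drule (1) cvec.span_diff) (simp add: algebra_simps)
lift_definition scaleC_tensor :: "complex \<Rightarrow> ('a, 'b) tensor \<Rightarrow> ('a, 'b) tensor" is scaleC
  unfolding tensor_eq_def cvec.scale_right_diff_distrib[symmetric] by (rule cvec.span_scale)
instance
  by (standard; transfer) (auto simp: algebra_simps)
end

lift_definition tensor :: "'u::complex_vector \<Rightarrow> 'v::complex_vector \<Rightarrow> ('u, 'v) tensor"
    (infixl \<open>\<otimes>\<close> 78) is pure .

text \<open>The map induced by a bilinear \<open>\<beta>\<close>, computed on an arbitrary representative; it is only
  used for bilinear \<open>\<beta>\<close>, where it does not depend on the representative (\<open>tensor_lift_tensor\<close>).\<close>

definition tensor_lift ::
    "('u::complex_vector \<Rightarrow> 'v::complex_vector \<Rightarrow> 'w::complex_vector) \<Rightarrow> ('u, 'v) tensor \<Rightarrow> 'w" where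
  "tensor_lift \<beta> t = (\<Sum>(u, v) \<in> Poly_Mapping.keys (rep_tensor t).
     Poly_Mapping.lookup (rep_tensor t) (u, v) *\<^sub>C \<beta> u v)"

definition cbilinear ::
    "('u::complex_vector \<Rightarrow> 'v::complex_vector \<Rightarrow> 'w::complex_vector) \<Rightarrow> bool" where
  "cbilinear \<beta> \<longleftrightarrow> (\<forall>u. clinear (\<beta> u)) \<and> (\<forall>v. clinear (\<lambda>u. \<beta> u v))"

definition free_lift :: "('a \<Rightarrow> 'w::complex_vector) \<Rightarrow> ('a \<Rightarrow>\<^sub>0 complex) \<Rightarrow> 'w" where
  "free_lift g p = (\<Sum>x \<in> Poly_Mapping.keys p. Poly_Mapping.lookup p x *\<^sub>C g x)"

lemma free_lift_superset:
  assumes "finite S" "Poly_Mapping.keys p \<subseteq> S"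
  shows "free_lift g p = (\<Sum>x \<in> S. Poly_Mapping.lookup p x *\<^sub>C g x)"
  unfolding free_lift_def
  by (rule sum.mono_neutral_left) (use assms in \<open>auto simp: in_keys_iff\<close>)

lemma lookup_scaleC: "Poly_Mapping.lookup (c *\<^sub>C p) x = c *\<^sub>C Poly_Mapping.lookup p x"
  by transfer simp

lemma clinear_free_lift: "clinear (free_lift g)"
proof (rule clinearI)
  fix p q :: "'a \<Rightarrow>\<^sub>0 complex" and c :: complex
  let ?S = "Poly_Mapping.keys p \<union> Poly_Mapping.keys q"
  have "Poly_Mapping.keys (p + q) \<subseteq> ?S" by (rule keys_add)
  then show "free_lift g (p + q) = free_lift g p + free_lift g q"
    by (simp add: free_lift_superset[of ?S] lookup_add algebra_simps sum.distrib)
  have "Poly_Mapping.keys (c *\<^sub>C p) \<subseteq> Poly_Mapping.keys p"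
    by (auto simp: in_keys_iff lookup_scaleC)
  then show "free_lift g (c *\<^sub>C p) = c *\<^sub>C free_lift g p"
    by (simp add: free_lift_superset[of "Poly_Mapping.keys p"] lookup_scaleC
        cvec.scale_sum_right scaleC_complex_def)
qed

lemma free_lift_single [simp]: "free_lift g (Poly_Mapping.single x 1) = g x"
  by (simp add: free_lift_def)

lemma free_lift_tensor_eq:
  assumes "cbilinear \<beta>" "tensor_eq p q"
  shows "free_lift (case_prod \<beta>) p = free_lift (case_prod \<beta>) q"
proof -
  note [simp] = clinearD[OF clinear_free_lift]
  have b: "clinear (\<beta> u)" "clinear (\<lambda>u. \<beta> u v)" for u v
    using assms(1) by (auto simp: cbilinear_def)
  have "p - q \<in> cvec.span tensor_relations"
    using assms(2) by (simp add: tensor_eq_def)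
  then have "free_lift (case_prod \<beta>) (p - q) = 0"
  proof (induction rule: cvec.span_induct_alt)
    case (step c x y)
    have "free_lift (case_prod \<beta>) x = 0"
      using step(1) by (auto simp: tensor_relations_def clinearD[OF b(1)] clinearD[OF b(2)])
    with step show ?case by simp
  qed simp
  then show ?thesis by simp
qed

lemma tensor_lift_abs:
  assumes "cbilinear \<beta>"
  shows "tensor_lift \<beta> (abs_tensor p) = free_lift (case_prod \<beta>) p"
proof -
  have "tensor_eq (rep_tensor (abs_tensor p)) p"
    using Quotient_rep_abs[OF Quotient_tensor, of p] by simp
  moreover have "tensor_lift \<beta> t = free_lift (case_prod \<beta>) (rep_tensor t)" for t
    by (simp add: tensor_lift_def free_lift_def case_prod_unfold)
  ultimately show ?thesis using free_lift_tensor_eq[OF assms] by metis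
qed

lemma tensor_lift_tensor: "cbilinear \<beta> \<Longrightarrow> tensor_lift \<beta> (u \<otimes> v) = \<beta> u v"
  by (simp add: tensor.abs_eq tensor_lift_abs)

lemma clinear_tensor_lift:
  assumes "cbilinear \<beta>"
  shows "clinear (tensor_lift \<beta>)"
proof (rule clinearI)
  fix s t :: "('a, 'b) tensor" and c :: complex
  obtain p q where "s = abs_tensor p" "t = abs_tensor q"
    by (metis Quotient_abs_rep[OF Quotient_tensor])
  then show "tensor_lift \<beta> (s + t) = tensor_lift \<beta> s + tensor_lift \<beta> t"
      "tensor_lift \<beta> (c *\<^sub>C s) = c *\<^sub>C tensor_lift \<beta> s"
    by (simp_all add: plus_tensor.abs_eq scaleC_tensor.abs_eq tensor_lift_abs[OF assms]
        clinearD[OF clinear_free_lift])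
qed

lemma cbilinear_tensor: "cbilinear (\<otimes>)"
  unfolding cbilinear_def
proof (intro conjI allI clinearI; transfer)
  fix c and u u' :: 'a and v v' :: 'b
  have "pure u (v + v') - pure u v - pure u v' \<in> tensor_relations"
    "pure (u + u') v - pure u v - pure u' v \<in> tensor_relations"
    "pure (c *\<^sub>C u) v - c *\<^sub>C pure u v \<in> tensor_relations"
    "pure u (c *\<^sub>C v) - c *\<^sub>C pure u v \<in> tensor_relations"
    unfolding tensor_relations_def by blast+
  then show "tensor_eq (pure u (v + v')) (pure u v + pure u v')"
    "tensor_eq (pure (u + u') v) (pure u v + pure u' v)"
    "tensor_eq (pure (c *\<^sub>C u) v) (c *\<^sub>C pure u v)"
    "tensor_eq (pure u (c *\<^sub>C v)) (c *\<^sub>C pure u v)"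
    unfolding tensor_eq_def by (simp_all add: cvec.span_base diff_diff_eq)
qed

definition tensor_map ::
    "('u \<Rightarrow> 'x) \<Rightarrow> ('v \<Rightarrow> 'y) \<Rightarrow> ('u::complex_vector, 'v::complex_vector) tensor
      \<Rightarrow> ('x::complex_vector, 'y::complex_vector) tensor" where
  "tensor_map f g = tensor_lift (\<lambda>u v. f u \<otimes> g v)"

definition tensor_flip :: "('u::complex_vector, 'v::complex_vector) tensor \<Rightarrow> ('v, 'u) tensor" where
  "tensor_flip = tensor_lift (\<lambda>u v. v \<otimes> u)"

section \<open>The conformal Yang-Baxter equation\<close>

text \<open>\<open>B \<otimes> B \<otimes> B\<close> is \<^typ>\<open>(('b, 'b) tensor, 'b) tensor\<close>.\<close>

abbreviation d1 :: "(('b, 'b) tensor, 'b) tensor \<Rightarrow> (('b::cd_module, 'b) tensor, 'b) tensor" where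
  "d1 \<equiv> tensor_map (tensor_map \<partial> id) id"
abbreviation d2 :: "(('b, 'b) tensor, 'b) tensor \<Rightarrow> (('b::cd_module, 'b) tensor, 'b) tensor" where
  "d2 \<equiv> tensor_map (tensor_map id \<partial>) id"
abbreviation d3 :: "(('b, 'b) tensor, 'b) tensor \<Rightarrow> (('b::cd_module, 'b) tensor, 'b) tensor" where
  "d3 \<equiv> tensor_map (tensor_map id id) \<partial>"

definition bullet_term ::
    "('b::cd_module \<Rightarrow> 'b \<Rightarrow> 'b poly) \<Rightarrow> 'b \<Rightarrow> 'b \<Rightarrow> 'b \<Rightarrow> 'b \<Rightarrow> (('b, 'b) tensor, 'b) tensor" where
  "bullet_term pr r\<^sub>i l\<^sub>i r\<^sub>j l\<^sub>j =
       psubst d1 (\<lambda>c. r\<^sub>i \<otimes> r\<^sub>j \<otimes> c) (pr l\<^sub>i l\<^sub>j)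
     - psubst (- (d1 + d2)) (\<lambda>c. r\<^sub>i \<otimes> c \<otimes> l\<^sub>j) (pr r\<^sub>j l\<^sub>i)
     + psubst d2 (\<lambda>c. c \<otimes> l\<^sub>i \<otimes> l\<^sub>j) (pr r\<^sub>i r\<^sub>j)"

definition bullet ::
    "('b::cd_module \<Rightarrow> 'b \<Rightarrow> 'b poly) \<Rightarrow> ('b, 'b) tensor \<Rightarrow> (('b, 'b) tensor, 'b) tensor" where
  "bullet pr r = tensor_lift (\<lambda>r\<^sub>i l\<^sub>i. tensor_lift (\<lambda>r\<^sub>j l\<^sub>j. bullet_term pr r\<^sub>i l\<^sub>i r\<^sub>j l\<^sub>j) r) r"

lemma clinear_tensor: "clinear (\<lambda>x. x \<otimes> y)" "clinear (\<lambda>y. x \<otimes> y)"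
  using cbilinear_tensor by (auto simp: cbilinear_def)

lemma clinear_tensor_map:
  assumes "clinear f" "clinear g"
  shows "clinear (tensor_map f g)"
  unfolding tensor_map_def
  by (rule clinear_tensor_lift)
    (auto simp: cbilinear_def clinear_iff clinearD[OF assms(1)] clinearD[OF assms(2)]
      clinearD[OF clinear_tensor(1)] clinearD[OF clinear_tensor(2)])

lemma tensor_lift_fun_clinear:
  assumes "\<And>u v. clinear (\<lambda>x. \<beta> x u v)"
  shows "clinear (\<lambda>x. tensor_lift (\<beta> x) t)"
  by (rule clinearI)
    (auto simp: tensor_lift_def clinearD[OF assms] case_prod_unfold algebra_simps sum.distrib
      cvec.scale_sum_right mult.commute)

lemma psubst_fun_clinear:
  assumes X: "clinear X" and g: "\<And>c. clinear (\<lambda>x. g x c)"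
  shows "clinear (\<lambda>x. psubst X (g x) p)"
  by (rule clinearI)
    (simp_all add: psubst_def clinearD[OF g] clinearD[OF funpow_clinear[OF X]] sum.distrib
      cvec.scale_sum_right)

lemma bullet_sum:
  fixes pr :: "'b::cd_module \<Rightarrow> 'b \<Rightarrow> 'b poly"
  assumes pr: "cbilinear pr"
  shows "bullet pr (\<Sum>i\<in>I. a i \<otimes> b i)
    = (\<Sum>i\<in>I. \<Sum>j\<in>I. bullet_term pr (a i) (b i) (a j) (b j))"
proof -
  have d: "clinear (d1 :: _ \<Rightarrow> (('b, 'b) tensor, 'b) tensor)"
    "clinear (d2 :: _ \<Rightarrow> (('b, 'b) tensor, 'b) tensor)"
    by (intro clinear_tensor_map clinear_partial; simp add: clinear_iff)+
  note d' = clinear_ops(3)[OF clinear_ops(1)[OF d]]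
  have p: "clinear (\<lambda>x. pr x y)" "clinear (\<lambda>y. pr x y)" for x y
    using pr by (auto simp: cbilinear_def)
  have comp: "clinear (\<lambda>x. f (g x))" if "clinear f" "clinear g"
    for f :: "'y::complex_vector \<Rightarrow> 'z::complex_vector" and g :: "'x::complex_vector \<Rightarrow> 'y"
    using that by (auto simp: clinear_iff)
  have t3: "clinear (\<lambda>x. x \<otimes> y \<otimes> z)" "clinear (\<lambda>y. x \<otimes> y \<otimes> z)" "clinear (\<lambda>z. x \<otimes> y \<otimes> z)"
    for x y z :: 'b
    by (rule clinear_tensor comp[OF clinear_tensor(1)])+
  have add: "clinear (\<lambda>x. f x + g x)" and sub: "clinear (\<lambda>x. f x - g x)"
    if "clinear f" "clinear g" for f g :: "'x::complex_vector \<Rightarrow> 'z::complex_vector"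
    using that by (auto simp: clinear_iff algebra_simps)
  note S = psubst_fun_clinear comp[OF clinear_psubst]
  have bt: "clinear (\<lambda>x. bullet_term pr x y z w)" "clinear (\<lambda>y. bullet_term pr x y z w)"
    "clinear (\<lambda>z. bullet_term pr x y z w)" "clinear (\<lambda>w. bullet_term pr x y z w)" for x y z w
    unfolding bullet_term_def by (intro add sub; (rule S; (rule d d' t3 p))+)+
  have 1: "cbilinear (\<lambda>z w. bullet_term pr x y z w)" for x y
    unfolding cbilinear_def using bt by blast
  have 2: "cbilinear (\<lambda>x y. tensor_lift (\<lambda>z w. bullet_term pr x y z w) t)" for t
    unfolding cbilinear_def by (intro conjI allI tensor_lift_fun_clinear bt)
  show ?thesis
    unfolding bullet_def
    by (rule trans[OF clinearD(6)[OF clinear_tensor_lift[OF 2]]], rule sum.cong[OF refl],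
        rule trans[OF tensor_lift_tensor[OF 2]],
        rule trans[OF clinearD(6)[OF clinear_tensor_lift[OF 1]]])
      (simp only: tensor_lift_tensor[OF 1])
qed

definition conformal_ybe :: "('b::cd_module \<Rightarrow> 'b \<Rightarrow> 'b poly) \<Rightarrow> ('b, 'b) tensor \<Rightarrow> bool" where
  "conformal_ybe pr r \<longleftrightarrow> bullet pr r \<in> range (d1 + d2 + d3)"

definition antisymmetric :: "('b::complex_vector, 'b) tensor \<Rightarrow> bool" where
  "antisymmetric r \<longleftrightarrow> tensor_flip r = - r"

text \<open>\<open>f \<otimes> a\<close> as the conformal map \<open>v \<mapsto> f\<^bsub>\<lambda>+\<partial>\<^esub>(v) a\<close>.\<close>

lift_definition rank_one :: "'m::cd_module cdual \<Rightarrow> 'a::cd_module \<Rightarrow> ('m, 'a) chom" is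
  "\<lambda>f a v. psubst (indet + \<partial>) (\<lambda>c. [:c *\<^sub>C a:]) (f v)"
proof -
  fix f :: "'m \<Rightarrow> complex poly" and a :: 'a
  assume "clinear f \<and> (\<forall>u. f (\<partial> u) = (\<partial> + indet) (f u))"
  then have f: "clinear f" and f': "f (\<partial> u) = \<partial> (f u) + indet (f u)" for u by auto
  have X: "clinear (indet + \<partial> :: 'a poly \<Rightarrow> _)"
    by (intro clinear_ops clinear_indet clinear_partial)
  have c: "clinear (\<lambda>c::complex. [:c *\<^sub>C a:])"
    by (rule clinearI) (auto simp: algebra_simps scaleC_complex_def scaleC_pCons)
  note S = clinear_psubst[OF X c]
  have 1: "clinear (\<lambda>v. psubst (indet + \<partial>) (\<lambda>c. [:c *\<^sub>C a:]) (f v))"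
    using S f by (auto simp: clinear_iff)
  have 2: "psubst (indet + \<partial>) (\<lambda>c. [:c *\<^sub>C a:]) (f (\<partial> v))
      = (\<partial> + indet) (psubst (indet + \<partial>) (\<lambda>c. [:c *\<^sub>C a:]) (f v))" for v
    by (simp add: f' psubst_pCons[OF X] partial_complex_poly)
  from 1 2 show "clinear (\<lambda>v. psubst (indet + \<partial>) (\<lambda>c. [:c *\<^sub>C a:]) (f v)) \<and>
      (\<forall>u. psubst (indet + \<partial>) (\<lambda>c. [:c *\<^sub>C a:]) (f (\<partial> u))
        = (\<partial> + indet) (psubst (indet + \<partial>) (\<lambda>c. [:c *\<^sub>C a:]) (f u)))" by blast
qed

definition chom_of_tensor :: "('m::cd_module cdual, 'a::cd_module) tensor \<Rightarrow> ('m, 'a) chom" where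
  "chom_of_tensor = tensor_lift rank_one"

lemma cbilinear_rank_one:
  "cbilinear (rank_one :: 'm::cd_module cdual \<Rightarrow> 'a::cd_module \<Rightarrow> ('m, 'a) chom)"
proof -
  let ?X = "indet + \<partial> :: 'a poly \<Rightarrow> 'a poly"
  have X: "clinear ?X"
    by (intro clinear_ops clinear_indet clinear_partial)
  have c: "clinear (\<lambda>c::complex. [:c *\<^sub>C a:])" "clinear (\<lambda>a. [:c *\<^sub>C a:])" for a :: 'a and c
    by (rule clinearI; auto simp: algebra_simps scaleC_complex_def scaleC_pCons mult.commute)+
  have "clinear (\<lambda>a. psubst ?X (\<lambda>c. [:c *\<^sub>C a:]) p)" for p
    by (rule psubst_fun_clinear[OF X c(2)])
  then show ?thesis
    using clinear_psubst[OF X c(1)]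
    by (auto simp: cbilinear_def clinear_iff capp_inject[symmetric] fun_eq_iff rank_one.rep_eq
        plus_chom.rep_eq scaleC_chom.rep_eq)
qed

lemma chom_of_tensor_tensor: "chom_of_tensor (f \<otimes> a) = rank_one f a"
  unfolding chom_of_tensor_def by (rule tensor_lift_tensor[OF cbilinear_rank_one])

definition tensor_of_chom :: "('m::cd_module, 'a::cd_module) chom \<Rightarrow> ('a, 'm cdual) tensor" where
  "tensor_of_chom T = tensor_flip (inv chom_of_tensor T)"

end

theory Submission
  imports Defs
begin

text \<open>
  Write \<open>T\<^sub>0(u) = \<Sum>\<^sub>p f\<^sub>p\<^sub>,\<^sub>\<partial>(u) a\<^sub>p\<close> for \<open>r\<^sub>T = \<Sum>\<^sub>p a\<^sub>p \<otimes> f\<^sub>p\<close>. By antisymmetry, and because the middle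
  substitution \<open>\<mu> = - \<partial>\<^sup>\<otimes>\<^sup>2 \<otimes> 1\<close> may be replaced by \<open>\<mu> = 1 \<otimes> 1 \<otimes> \<partial>\<close>, modulo \<open>\<partial>\<^sup>\<otimes>\<^sup>3\<close> the element
  \<open>r \<bullet> r\<close> is the sum of the three cyclic rotations of a single \<open>Y \<in> M\<^sup>* \<otimes> M\<^sup>* \<otimes> A\<close>. The functionals
  \<open>f \<otimes> g \<otimes> a \<mapsto> f\<^bsub>-\<lambda>\<^esub>(u) g\<^bsub>\<lambda>+\<partial>\<^esub>(v) a\<close> vanish on the other two rotations and, by means of a dual basis of
  \<open>M\<close>, detect whether \<open>Y\<close> lies in the image of \<open>\<partial>\<^sup>\<otimes>\<^sup>3\<close>. Their value on \<open>Y\<close> is the defect of the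
  O-operator identity for \<open>T\<^sub>0\<close> at \<open>u, v\<close>.
\<close>

section \<open>Linear algebra and polynomial substitution\<close>

lemma clinear_compose: "clinear f \<Longrightarrow> clinear g \<Longrightarrow> clinear (\<lambda>x. f (g x))"
  by (simp add: clinear_iff)

lemma clinear_ident: "clinear (\<lambda>x. x)"
  by (simp add: clinear_iff)

lemma clinear_fst: "clinear fst" and clinear_snd: "clinear snd"
  by (auto simp: clinear_iff scaleC_prod_def)

lemma clinear_inl: "clinear (\<lambda>a. (a, 0))" and clinear_inr: "clinear (\<lambda>b. (0, b))"
  by (auto simp: clinear_iff scaleC_prod_def)

lemma clinear_const_poly: "clinear (\<lambda>c. [:c:])"
  by (simp add: clinear_iff scaleC_pCons)

lemma subspace_range: "clinear f \<Longrightarrow> cvec.subspace (range f)"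
  by (auto simp: cvec.subspace_def clinearD(1,2)[symmetric] intro: range_eqI[of _ _ 0] clinearD(3)[symmetric])

lemma subspace_vimage: "clinear f \<Longrightarrow> cvec.subspace S \<Longrightarrow> cvec.subspace (f -` S)"
  by (simp add: cvec.subspace_def clinearD)

lemma psubst_mem_subspace:
  assumes "cvec.subspace S" "\<And>x. x \<in> S \<Longrightarrow> X x \<in> S" "\<And>k. f (coeff p k) \<in> S"
  shows "psubst X f p \<in> S"
proof -
  have "(X ^^ k) x \<in> S" if "x \<in> S" for k x
    using that by (induction k) (auto simp: assms(2))
  then show ?thesis
    unfolding psubst_def by (intro cvec.subspace_sum assms(1)) (auto intro: assms(3))
qed

lemma psubst_map_poly:
  assumes "clinear X" "f 0 = 0" "g 0 = 0"
  shows "psubst X f (map_poly g p) = psubst X (\<lambda>c. f (g c)) p"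
  by (induction p) (auto simp: psubst_0 map_poly_pCons psubst_pCons assms)

lemma at1_indet: "at1 indet p = (p :: 'a::complex_vector poly)"
  by (induction p) (simp_all add: psubst_0 psubst_pCons[OF clinear_indet])

text \<open>For commuting \<open>X\<close> and \<open>Y\<close>, every X^k - Y^k is divisible by X -
  Y. Hence one substitution can be traded for another modulo the image of the difference.\<close>

lemma psubst_diff_mem:
  assumes X: "clinear X" "clinear Y" and XY: "\<And>x. X (Y x) = Y (X x)" and g: "g 0 = 0"
  shows "psubst X g p - psubst Y g p \<in> range (X - Y)"
proof -
  have sub: "cvec.subspace (range (X - Y))"
    by (intro subspace_range clinear_ops X)
  show ?thesis
  proof (induction p)
    case 0
    show ?case by (simp only: psubst_0[of g, OF g] diff_self cvec.subspace_0[OF sub])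
  next
    case (pCons a p)
    then obtain z where z: "psubst X g p - psubst Y g p = X z - Y z" by auto
    have "psubst X g (pCons a p) - psubst Y g (pCons a p)
        = X (psubst X g p - psubst Y g p) + (X - Y) (psubst Y g p)"
      by (simp add: psubst_pCons X g clinearD(5)[OF X(1)])
    also have "X (psubst X g p - psubst Y g p) = (X - Y) (X z)"
      by (simp add: z XY clinearD(5)[OF X(1)])
    finally show ?case
      using cvec.subspace_add[OF sub] by auto
  qed
qed

section \<open>Scalar polynomials acting through an operator\<close>

text \<open>The value f_\<nu>(u) of a functional is a scalar polynomial. Here it acts with \<nu>
  replaced by an arbitrary operator, such as -\<lambda> or \<lambda> + \<partial> on A[\<lambda>];
  \<open>dact\<close> is the case of \<partial> alone.\<close>

definition poly_act :: "('a::complex_vector \<Rightarrow> 'a) \<Rightarrow> complex poly \<Rightarrow> 'a \<Rightarrow> 'a" where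
  "poly_act X p y = psubst X (\<lambda>c. c *\<^sub>C y) p"

lemma poly_act_0 [simp]: "poly_act X 0 y = 0"
  by (simp add: poly_act_def psubst_0)

lemma poly_act_pCons: "clinear X \<Longrightarrow> poly_act X (pCons c p) y = c *\<^sub>C y + X (poly_act X p y)"
  by (simp add: poly_act_def psubst_pCons)

lemma clinear_poly_act_left: "clinear X \<Longrightarrow> clinear (\<lambda>p. poly_act X p y)"
  unfolding poly_act_def
  by (rule clinear_psubst) (auto simp: clinear_iff algebra_simps scaleC_complex_def)

lemma clinear_poly_act: "clinear X \<Longrightarrow> clinear (poly_act X p)"
  unfolding poly_act_def[abs_def]
  by (rule psubst_fun_clinear) (auto simp: clinear_iff algebra_simps mult.commute)

lemma poly_act_comm:
  assumes "clinear X" "clinear Y" "clinear Z" "\<And>x. Z (X x) = Y (Z x)"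
  shows "Z (poly_act X p y) = poly_act Y p (Z y)"
  by (simp add: poly_act_def psubst_comm[OF assms] clinearD(2)[OF assms(3)])

lemma dact_eq_poly_act: "dact p v = poly_act \<partial> p v"
  by (simp add: dact_def poly_act_def)

lemma pCons_partial: "[:\<partial> a:] = \<partial> [:a:]"
  by (simp add: poly_eq_iff coeff_pCons clinearD[OF clinear_partial] split: nat.splits)

lemma poly_act_partial_const: "poly_act \<partial> p [:a:] = [:dact p (a :: 'a::cd_module):]"
  by (simp add: dact_eq_poly_act)
    (rule poly_act_comm[symmetric], auto simp: clinear_partial clinear_const_poly pCons_partial)

lemma rank_one_app: "rank_one f a \<cdot> v = poly_act (indet + \<partial>) (f \<cdot> v) [:a:]"
  by (simp add: rank_one.rep_eq poly_act_def scaleC_pCons)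

lemma clinear_indet_partial: "clinear (indet + \<partial> :: 'a::cd_module poly \<Rightarrow> _)"
  "clinear (- indet - \<partial> :: 'a::cd_module poly \<Rightarrow> _)" "clinear (- indet :: 'a::cd_module poly \<Rightarrow> _)"
  by (intro clinear_ops clinear_indet clinear_partial)+

text \<open>Setting \<lambda> = 0 intertwines \<lambda> + \<partial> with \<partial>. So each
  summand f \<otimes> a of a preimage of T contributes f_\<partial>(v) a to T_0(v).\<close>

lemma coeff_0_rank_one: "coeff (rank_one f a \<cdot> v) 0 = dact (f \<cdot> v) a"
proof -
  have "coeff (poly_act (indet + \<partial>) p y) 0 = dact p (coeff y 0)" for p and y :: "'a poly"
    unfolding dact_eq_poly_act
    by (rule poly_act_comm[OF clinear_indet_partial(1) clinear_partial, where Z = "\<lambda>p. coeff p 0"])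
      (simp_all add: clinear_iff)
  then show ?thesis by (simp add: rank_one_app)
qed

section \<open>Contragredient maps\<close>

text \<open>Comparing complex coefficients gives a form of the condition that can be checked
  directly for sums and scalar multiples.\<close>

lemma is_cdual_map_iff:
  "is_cdual_map x y \<longleftrightarrow> (\<forall>f u j k. coeff (coeff (y \<cdot> f) k \<cdot> u) j
     = coeff (coeff (psubst lam (\<lambda>w. at2 (mu - lam) (f \<cdot> w)) (x \<cdot> u)) j) k)"
  by (auto simp: is_cdual_map_def poly_eq_iff coeff_psubst_lam)

lemma clinear_at2_diff: "clinear (at2 (mu - lam) :: 'a::complex_vector poly \<Rightarrow> _)"
  by (intro clinear_psubst clinear_ops clinear_indet clinear_lam) (simp add: clinear_iff scaleC_pCons)

text \<open>\<open>cdual_rep\<close> is a definite description, so linearity comes from uniqueness: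
  sums and multiples of contragredients satisfy the condition that characterises the contragredient
  of the sum or multiple.\<close>

lemma clinear_cdual_rep:
  fixes l :: "'a::complex_vector \<Rightarrow> 'm::cd_module cend"
  assumes "cd_finite TYPE('m)" and l: "clinear l"
  shows "clinear (cdual_rep l)"
proof -
  note rep = cdual_rep[OF assms(1), of l]
  have c: "clinear (psubst lam (\<lambda>w. at2 (mu - lam) (f \<cdot> w)))" for f :: "'m cdual"
    by (intro clinear_psubst clinear_lam clinear_compose[OF clinear_at2_diff] clinear_capp)
  show ?thesis
  proof (rule clinearI)
    fix x y c
    have "is_cdual_map (l (x + y)) (cdual_rep l x + cdual_rep l y)"
      using rep[of x] rep[of y]
      by (simp add: is_cdual_map_iff plus_chom.rep_eq clinearD(1)[OF c] clinearD(1)[OF l])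
    then show "cdual_rep l (x + y) = cdual_rep l x + cdual_rep l y"
      by (rule cdual_map_unique[OF rep])
    have "is_cdual_map (l (c *\<^sub>C x)) (c *\<^sub>C cdual_rep l x)"
      using rep[of x]
      by (simp add: is_cdual_map_iff scaleC_chom.rep_eq clinearD(2)[OF c] clinearD(2)[OF l])
    then show "cdual_rep l (c *\<^sub>C x) = c *\<^sub>C cdual_rep l x"
      by (rule cdual_map_unique[OF rep])
  qed
qed

text \<open>The defining identity of the contragredient, evaluated at \<open>\<lambda> = X\<close> and \<open>\<mu> = Y\<close>.\<close>

lemma cdual_map_eval:
  fixes X Y :: "'v::complex_vector \<Rightarrow> 'v"
  assumes dual: "is_cdual_map x x'"
    and X: "clinear X" and Y: "clinear Y" and XY: "\<And>z. X (Y z) = Y (X z)"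
  shows "psubst X (\<lambda>h. poly_act Y (h \<cdot> u) y) (x' \<cdot> f)
    = psubst X (\<lambda>w. poly_act (Y - X) (f \<cdot> w) y) (x \<cdot> u)"
proof -
  \<comment> \<open>Evaluation at \<lambda> = X and \<mu> = Y, applied to \<open>y\<close>. As \<mu>
    is the outer indeterminate, moving \<open>lam\<close> through \<open>e\<close> is where
    \<open>X\<close> has to commute with \<open>Y\<close>.\<close>
  define e where "e = psubst Y (psubst X (\<lambda>c. c *\<^sub>C y))"
  have sc: "clinear (\<lambda>c::complex. c *\<^sub>C y)"
    by (simp add: clinear_iff algebra_simps scaleC_complex_def)
  have in_lin: "clinear (psubst X (\<lambda>c. c *\<^sub>C y))"
    by (rule clinear_psubst[OF X sc])
  have e_lin: "clinear e"
    unfolding e_def by (rule clinear_psubst[OF Y in_lin])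
  have e_mu: "e (mu q) = Y (e q)" for q
    by (simp add: e_def psubst_pCons[OF Y] clinearD(3)[OF in_lin])
  have e_lam: "e (lam q) = X (e q)" for q
    unfolding e_def
    by (induction q)
      (simp_all add: map_poly_pCons psubst_0 psubst_pCons[OF Y] psubst_pCons[OF X] clinearD(3)[OF in_lin]
        clinearD(1,3)[OF X] XY)
  have e_const: "e [:[:c:]:] = c *\<^sub>C y" for c
    by (simp add: e_def psubst_pCons[OF Y] psubst_pCons[OF X] psubst_0 clinearD(3)[OF X] clinearD(3)[OF Y])
  have e_at2: "e (at2 Z p) = poly_act W p y"
    if "clinear Z" "clinear W" "\<And>q. e (Z q) = W (e q)" for Z W p
    unfolding poly_act_def by (subst psubst_comm[OF that(1,2) e_lin that(3)]) (simp_all add: e_const)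
  have "e (psubst lam (\<lambda>g. at2 mu (g \<cdot> u)) (x' \<cdot> f)) = psubst X (\<lambda>h. poly_act Y (h \<cdot> u) y) (x' \<cdot> f)"
    by (subst psubst_comm[OF clinear_lam X e_lin e_lam])
      (simp_all add: zero_chom.rep_eq psubst_0 e_at2[OF clinear_indet Y e_mu])
  moreover have "e (psubst lam (\<lambda>w. at2 (mu - lam) (f \<cdot> w)) (x \<cdot> u))
      = psubst X (\<lambda>w. poly_act (Y - X) (f \<cdot> w) y) (x \<cdot> u)"
  proof -
    have "e ((mu - lam) q) = (Y - X) (e q)" for q
      by (simp add: clinearD(5)[OF e_lin] e_mu e_lam)
    then have "e (at2 (mu - lam) p) = poly_act (Y - X) p y" for p
      by (intro e_at2 clinear_ops clinear_indet clinear_lam X Y)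
    moreover have "e (psubst lam (\<lambda>w. at2 (mu - lam) (f \<cdot> w)) (x \<cdot> u))
        = psubst X (\<lambda>w. e (at2 (mu - lam) (f \<cdot> w))) (x \<cdot> u)"
      by (rule psubst_comm[OF clinear_lam X e_lin e_lam])
        (simp add: clinearD(3)[OF clinear_capp] psubst_0)
    ultimately show ?thesis by simp
  qed
  ultimately show ?thesis
    using dual by (simp add: is_cdual_map_def)
qed

section \<open>Tensors\<close>

text \<open>Scalars are absorbed into the first factor, so every tensor is a sum of pure tensors and
  no separate case for scalar multiples arises.\<close>

lemma tensor_induct [case_names tensor add]:
  assumes "\<And>u v. P (u \<otimes> v)" "\<And>s t. P s \<Longrightarrow> P t \<Longrightarrow> P (s + t)"
  shows "P t"
proof -
  obtain p where "t = abs_tensor p"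
    by (metis Quotient_abs_rep[OF Quotient_tensor])
  moreover have "P (abs_tensor p)"
  proof (induction p rule: update_induct)
    case const
    have "abs_tensor 0 = (0 :: ('a, 'b) tensor)"
      by (simp add: zero_tensor_def)
    also have "\<dots> = 0 \<otimes> 0"
      by (simp add: clinearD(3)[OF clinear_tensor(1)])
    finally show ?case by (simp add: assms(1))
  next
    case (update p k c)
    obtain u v where k: "k = (u, v)" by (cases k)
    \<comment> \<open>The key \<open>k\<close> does not occur in \<open>p\<close>, so the update is
      an addition.\<close>
    have "Poly_Mapping.update k c p = c *\<^sub>C pure u v + p"
      using update(1) by (intro poly_mapping_eqI)
        (auto simp: lookup_update lookup_add lookup_scaleC lookup_single k when_def scaleC_complex_def
          in_keys_iff)
    then have "abs_tensor (Poly_Mapping.update k c p) = c *\<^sub>C (u \<otimes> v) + abs_tensor p"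
      by (simp add: tensor.abs_eq scaleC_tensor.abs_eq plus_tensor.abs_eq)
    also have "\<dots> = (c *\<^sub>C u) \<otimes> v + abs_tensor p"
      by (simp add: clinearD(2)[OF clinear_tensor(1)])
    finally show ?case by (simp add: assms update)
  qed
  ultimately show ?thesis by simp
qed

lemma tensor_eq_sum:
  obtains n :: nat and u v where "t = (\<Sum>i<n. u i \<otimes> v i)"
proof -
  have "\<exists>xs. t = sum_list (map (\<lambda>(u, v). u \<otimes> v) xs)"
  proof (induction t rule: tensor_induct)
    case (tensor u v)
    show ?case by (rule exI[of _ "[(u, v)]"]) simp
  next
    case (add s t)
    then show ?case by (metis map_append sum_list_append)
  qed
  then obtain xs where "t = sum_list (map (\<lambda>(u, v). u \<otimes> v) xs)" ..
  then have "t = (\<Sum>i<length xs. fst (xs ! i) \<otimes> snd (xs ! i))"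
    by (simp add: sum_list_sum_nth atLeast0LessThan case_prod_unfold)
  then show thesis by (rule that)
qed

lemma cbilinearI:
  "(\<And>v. clinear (\<lambda>u. \<beta> u v)) \<Longrightarrow> (\<And>u. clinear (\<beta> u)) \<Longrightarrow> cbilinear \<beta>"
  by (simp add: cbilinear_def)

lemma tensor_map_tensor:
  assumes "clinear f" "clinear g"
  shows "tensor_map f g (u \<otimes> v) = f u \<otimes> g v"
  unfolding tensor_map_def
  by (rule tensor_lift_tensor, rule cbilinearI)
    (intro clinear_compose[OF clinear_tensor(1) assms(1)] clinear_compose[OF clinear_tensor(2) assms(2)])+

lemma cbilinear_flip_tensor: "cbilinear (\<lambda>u v. v \<otimes> u)"
  by (intro cbilinearI clinear_tensor)

lemma clinear_tensor_flip: "clinear tensor_flip"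
  unfolding tensor_flip_def by (rule clinear_tensor_lift[OF cbilinear_flip_tensor])

lemma tensor_flip_tensor: "tensor_flip (u \<otimes> v) = v \<otimes> u"
  unfolding tensor_flip_def by (rule tensor_lift_tensor[OF cbilinear_flip_tensor])

lemma tensor_flip_flip: "tensor_flip (tensor_flip t) = t"
  by (induction t rule: tensor_induct)
    (simp_all add: tensor_flip_tensor clinearD(1)[OF clinear_tensor_flip])

lemma antisymmetric_diff_flip: "antisymmetric (t - tensor_flip t)"
  by (simp add: antisymmetric_def clinearD(5)[OF clinear_tensor_flip] tensor_flip_flip)

section \<open>Triple tensors, cyclic rotation and the total derivation\<close>

lemma tensor3_eqI:
  assumes "clinear F" "clinear G" "\<And>x y z. F (x \<otimes> y \<otimes> z) = G (x \<otimes> y \<otimes> z)"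
  shows "F t = G t"
proof (induction t rule: tensor_induct)
  case (tensor s z)
  show ?case
    by (induction s rule: tensor_induct)
      (simp_all add: assms(3) clinearD(1)[OF clinear_tensor(1)] clinearD(1)[OF assms(1)]
        clinearD(1)[OF assms(2)])
qed (simp add: clinearD(1)[OF assms(1)] clinearD(1)[OF assms(2)])

definition tensor3_lift where
  "tensor3_lift \<beta> = tensor_lift (\<lambda>t z. tensor_lift (\<lambda>x y. \<beta> x y z) t)"

lemma
  assumes "\<And>y z. clinear (\<lambda>x. \<beta> x y z)" "\<And>x z. clinear (\<lambda>y. \<beta> x y z)" "\<And>x y. clinear (\<lambda>z. \<beta> x y z)"
  shows clinear_tensor3_lift: "clinear (tensor3_lift \<beta>)"
    and tensor3_lift_tensor: "tensor3_lift \<beta> (x \<otimes> y \<otimes> z) = \<beta> x y z"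
proof -
  have 1: "cbilinear (\<lambda>x y. \<beta> x y z)" for z
    by (intro cbilinearI assms)
  have 2: "cbilinear (\<lambda>t z. tensor_lift (\<lambda>x y. \<beta> x y z) t)"
    by (intro cbilinearI clinear_tensor_lift 1 tensor_lift_fun_clinear assms)
  show "clinear (tensor3_lift \<beta>)" "tensor3_lift \<beta> (x \<otimes> y \<otimes> z) = \<beta> x y z"
    unfolding tensor3_lift_def by (simp_all add: clinear_tensor_lift[OF 2] tensor_lift_tensor 1 2)
qed

lemma clinear_tensor3:
  "clinear (\<lambda>x. x \<otimes> y \<otimes> z)" "clinear (\<lambda>y. x \<otimes> y \<otimes> z)" "clinear (\<lambda>z. x \<otimes> y \<otimes> z)"
  by (rule clinear_tensor clinear_compose[OF clinear_tensor(1)])+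

definition rot :: "(('b::complex_vector, 'b) tensor, 'b) tensor \<Rightarrow> (('b, 'b) tensor, 'b) tensor" where
  "rot = tensor3_lift (\<lambda>x y z. z \<otimes> x \<otimes> y)"

lemma clinear_rot: "clinear rot"
  unfolding rot_def by (intro clinear_tensor3_lift clinear_tensor3)

lemma rot_tensor: "rot (x \<otimes> y \<otimes> z) = z \<otimes> x \<otimes> y"
  unfolding rot_def by (intro tensor3_lift_tensor clinear_tensor3)

lemma rot_rot_rot: "rot (rot (rot t)) = t"
  by (rule tensor3_eqI[OF clinear_compose[OF clinear_rot clinear_compose[OF clinear_rot clinear_rot]]
        clinear_ident])
    (simp add: rot_tensor)

abbreviation d_total :: "(('b, 'b) tensor, 'b) tensor \<Rightarrow> (('b::cd_module, 'b) tensor, 'b) tensor" where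
  "d_total \<equiv> d1 + d2 + d3"

lemma clinear_id: "clinear id"
  by (simp add: clinear_iff)

lemma clinear_d:
  "clinear (d1 :: (('b::cd_module, 'b) tensor, 'b) tensor \<Rightarrow> _)"
  "clinear (d2 :: (('b::cd_module, 'b) tensor, 'b) tensor \<Rightarrow> _)"
  "clinear (d3 :: (('b::cd_module, 'b) tensor, 'b) tensor \<Rightarrow> _)"
  by (intro clinear_tensor_map clinear_partial clinear_id)+

lemma clinear_d_total: "clinear (d_total :: (('b::cd_module, 'b) tensor, 'b) tensor \<Rightarrow> _)"
  by (intro clinear_ops clinear_d)

lemma d_tensor:
  "d1 (x \<otimes> y \<otimes> z) = \<partial> x \<otimes> y \<otimes> z" "d2 (x \<otimes> y \<otimes> z) = x \<otimes> \<partial> y \<otimes> z"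
  "d3 (x \<otimes> y \<otimes> z) = x \<otimes> y \<otimes> \<partial> z"
  by (simp_all add: tensor_map_tensor clinear_tensor_map clinear_partial clinear_id)

lemma d_comm:
  "d1 (d2 t) = d2 (d1 t)" "d1 (d3 t) = d3 (d1 t)" "d2 (d3 t) = d3 (d2 t)"
  by (rule tensor3_eqI[OF clinear_compose[OF clinear_d(1) clinear_d(2)] clinear_compose[OF clinear_d(2) clinear_d(1)]]
      tensor3_eqI[OF clinear_compose[OF clinear_d(1) clinear_d(3)] clinear_compose[OF clinear_d(3) clinear_d(1)]]
      tensor3_eqI[OF clinear_compose[OF clinear_d(2) clinear_d(3)] clinear_compose[OF clinear_d(3) clinear_d(2)]],
    simp add: d_tensor)+

lemma rot_d:
  "rot (d1 t) = d2 (rot t)" "rot (d2 t) = d3 (rot t)" "rot (d3 t) = d1 (rot t)"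
  by (rule tensor3_eqI[OF clinear_compose[OF clinear_rot clinear_d(1)] clinear_compose[OF clinear_d(2) clinear_rot]]
      tensor3_eqI[OF clinear_compose[OF clinear_rot clinear_d(2)] clinear_compose[OF clinear_d(3) clinear_rot]]
      tensor3_eqI[OF clinear_compose[OF clinear_rot clinear_d(3)] clinear_compose[OF clinear_d(1) clinear_rot]],
    simp add: d_tensor rot_tensor)+

lemma rot_d_total: "rot (d_total t) = d_total (rot t)"
  by (simp add: clinearD(1)[OF clinear_rot] rot_d)

lemma d_total_comm: "d1 (d_total t) = d_total (d1 t)" "d2 (d_total t) = d_total (d2 t)"
  by (simp_all add: clinearD(1)[OF clinear_d(1)] clinearD(1)[OF clinear_d(2)] d_comm)

lemmas subspace_range_d_total = subspace_range[OF clinear_d_total]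

lemma rot_range_d_total: "t \<in> range d_total \<Longrightarrow> rot t \<in> range d_total"
  by (erule rangeE) (simp only: rot_d_total rangeI)

section \<open>Cyclic form of the Yang-Baxter expression\<close>

text \<open>The shape of the first summand of \<open>bullet_term\<close>. The third summand is a
  rotation of this shape, and so is the second one modulo the total derivation.\<close>

definition third_slot ::
    "'b::cd_module \<Rightarrow> 'b \<Rightarrow> 'b poly \<Rightarrow> (('b, 'b) tensor, 'b) tensor" where
  "third_slot x y p = psubst d1 (\<lambda>c. x \<otimes> y \<otimes> c) p"

lemma clinear_third_slot: "clinear (third_slot x y)"
  "clinear (\<lambda>x. third_slot x y p)" "clinear (\<lambda>y. third_slot x y p)"
  unfolding third_slot_def[abs_def]
  by (intro clinear_psubst psubst_fun_clinear clinear_d clinear_tensor3)+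

text \<open>Rotation carries \<open>d1\<close> to \<open>d2\<close> and \<open>d2\<close> to
  \<open>d3\<close>, so the operator substituted for \<mu> moves along with the factors.\<close>

lemma rot_third_slot:
  "rot (third_slot x y p) = psubst d2 (\<lambda>c. c \<otimes> x \<otimes> y) p"
  "rot (rot (third_slot x y p)) = psubst d3 (\<lambda>c. y \<otimes> c \<otimes> x) p"
proof -
  show 1: "rot (third_slot x y p) = psubst d2 (\<lambda>c. c \<otimes> x \<otimes> y) p"
    unfolding third_slot_def
    by (subst psubst_comm[OF clinear_d(1) clinear_d(2) clinear_rot])
      (simp_all add: rot_d rot_tensor clinearD(3)[OF clinear_tensor3(3)])
  show "rot (rot (third_slot x y p)) = psubst d3 (\<lambda>c. y \<otimes> c \<otimes> x) p"
    unfolding 1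
    by (subst psubst_comm[OF clinear_d(2) clinear_d(3) clinear_rot])
      (simp_all add: rot_d rot_tensor clinearD(3)[OF clinear_tensor3(1)])
qed

text \<open>Modulo \<open>\<partial>\<^sup>\<otimes>\<^sup>3\<close> the substitution \<open>\<mu> = - \<partial>\<^sup>\<otimes>\<^sup>2 \<otimes> 1\<close> in the middle summand becomes \<open>\<mu> = 1 \<otimes> 1 \<otimes> \<partial>\<close>,
  so that all three summands are rotations of the first one.\<close>

lemma bullet_term_cyclic:
  "bullet_term pr x l y l' - (third_slot x y (pr l l') - rot (rot (third_slot l' x (pr y l)))
    + rot (third_slot l l' (pr x y))) \<in> range d_total"
proof -
  have "psubst d3 (\<lambda>c. x \<otimes> c \<otimes> l') (pr y l) - psubst (- (d1 + d2)) (\<lambda>c. x \<otimes> c \<otimes> l') (pr y l)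
      \<in> range (d3 - - (d1 + d2))"
    by (rule psubst_diff_mem)
      (auto simp: clinear_ops clinear_d d_comm clinearD[OF clinear_d(3)] clinearD(3)[OF clinear_tensor3(2)])
  \<comment> \<open>The two operators substituted for \<mu> differ exactly by the total
    derivation.\<close>
  also have "d3 - - (d1 + d2) = (d_total :: (('a, 'a) tensor, 'a) tensor \<Rightarrow> _)"
    by (simp add: fun_eq_iff algebra_simps)
  also have "psubst d3 (\<lambda>c. x \<otimes> c \<otimes> l') (pr y l) - psubst (- (d1 + d2)) (\<lambda>c. x \<otimes> c \<otimes> l') (pr y l)
      = bullet_term pr x l y l' - (third_slot x y (pr l l') - rot (rot (third_slot l' x (pr y l)))
        + rot (third_slot l l' (pr x y)))"
  proof -
    have "b' - b = (a - b + c) - (a - b' + c)" for a b b' c :: "(('a, 'a) tensor, 'a) tensor"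
      by (simp add: algebra_simps)
    then show ?thesis
      unfolding bullet_term_def rot_third_slot(2) unfolding rot_third_slot(1) unfolding third_slot_def .
  qed
  finally show ?thesis .
qed

section \<open>Dual bases\<close>

lemma cd_subspaceI:
  assumes "cvec.subspace V" "\<And>x. x \<in> V \<Longrightarrow> \<partial> x \<in> V"
  shows "cd.subspace V"
  using assms(1)
  by (intro cd.subspaceI) (auto simp: cvec.subspace_0 cvec.subspace_add cvec.subspace_scale dact_def
      intro!: psubst_mem_subspace assms)

lemma clinear_capp_left: "clinear (\<lambda>a. a \<cdot> u)"
  by (simp add: clinear_iff plus_chom.rep_eq scaleC_chom.rep_eq)

text \<open>By sesquilinearity the vectors on which two conformal maps agree form a
  C[\<partial>]-submodule.\<close>

lemma chom_eq_on_span: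
  assumes "\<And>s. s \<in> S \<Longrightarrow> a \<cdot> s = b \<cdot> s" "cd.span S = UNIV"
  shows "a = b"
proof -
  have "cd.subspace {u. a \<cdot> u = b \<cdot> u}"
    by (rule cd_subspaceI) (auto simp: cvec.subspace_def clinearD[OF clinear_capp] capp_partial)
  then have "cd.span S \<subseteq> {u. a \<cdot> u = b \<cdot> u}"
    using assms(1) by (intro cd.span_minimal) auto
  then show ?thesis
    using assms(2) by (auto simp: capp_inject[symmetric] fun_eq_iff)
qed

lemma capp_dact: "dact p a \<cdot> u = poly_act (- indet) p (a \<cdot> u)"
  unfolding dact_eq_poly_act
  by (rule poly_act_comm[OF clinear_partial clinear_indet_partial(3) clinear_capp_left])
    (simp add: cpartial_chom.rep_eq)

text \<open>Here 1 and 0 are constant polynomials in \<lambda>. The Kronecker condition also forces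
  \<open>S\<close> to be independent over C[\<partial>].\<close>

definition dual_basis :: "'m::cd_module set \<Rightarrow> ('m \<Rightarrow> 'm cdual) \<Rightarrow> bool" where
  "dual_basis S e \<longleftrightarrow> finite S \<and> cd.span S = UNIV
    \<and> (\<forall>s\<in>S. \<forall>s'\<in>S. e s \<cdot> s' = (if s = s' then 1 else 0))"

text \<open>The functionals are the coordinates with respect to a free basis. That basis is finite:
  finitely many generators involve only finitely many basis vectors, these already span, and an
  independent set has no proper spanning subset.\<close>

lemma dual_basis_exists:
  assumes "cd_finite TYPE('m::cd_module)" "cd_free TYPE('m)"
  shows "\<exists>S (e :: 'm \<Rightarrow> 'm cdual). dual_basis S e"
proof -
  obtain S :: "'m set" where S: "\<not> cd.dependent S" "cd.span S = UNIV"
    using assms(2) by (auto simp: cd_free_def)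
  obtain G :: "'m set" where G: "finite G" "cd.span G = UNIV"
    using assms(1) by (auto simp: cd_finite_def)
  let ?R = "cd.representation S"
  have "finite S"
  proof -
    define B where "B = (\<Union>g\<in>G. {s. ?R g s \<noteq> 0})"
    have fin: "finite B" and BS: "B \<subseteq> S"
      using G(1) by (auto simp: B_def cd.finite_representation dest: cd.representation_ne_zero)
    have "g \<in> cd.span B" if "g \<in> G" for g
    proof -
      have "(\<Sum>s | ?R g s \<noteq> 0. dact (?R g s) s) = g"
        by (rule cd.sum_nonzero_representation_eq) (auto simp: S)
      moreover have "(\<Sum>s | ?R g s \<noteq> 0. dact (?R g s) s) \<in> cd.span B"
        using that by (intro cd.span_sum cd.span_scale cd.span_base) (auto simp: B_def)
      ultimately show ?thesis by simp
    qed
    then have "cd.span G \<subseteq> cd.span B"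
      by (intro cd.span_minimal cd.subspace_span) auto
    then have "S = B"
      using cd.spanning_subset_independent[OF BS S(1)] G(2) by auto
    then show ?thesis using fin by simp
  qed
  define e where "e s = Abs_chom (\<lambda>v. ?R v s)" for s
  have act: "dact [:c:] v = c *\<^sub>C v" "dact [:0, 1:] v = \<partial> v" for c and v :: 'm
    by (simp_all add: dact_eq_poly_act poly_act_pCons clinear_partial clinearD(3)[OF clinear_partial])
  have "?R (c *\<^sub>C v) s = c *\<^sub>C ?R v s" for c v s
    using cd.representation_scale[OF S(1), of v "[:c:]"]
    by (simp add: S act poly_eq_iff scaleC_complex_def)
  \<comment> \<open>Since \<partial> is zero on C, sesquilinearity of a functional says that
    \<partial> on the vector multiplies the value by \<lambda>, which is what coordinates
    do.\<close>
  moreover have "?R (\<partial> v) s = (\<partial> + indet) (?R v s)" for v s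
    using cd.representation_scale[OF S(1), of v "[:0, 1:]"]
    by (simp add: S act partial_complex_poly)
  moreover have "?R (u + v) s = ?R u s + ?R v s" for u v s
    using cd.representation_add[OF S(1), of v u] by (simp add: S)
  ultimately have "e s \<cdot> v = ?R v s" for s v
    unfolding e_def by (subst Abs_chom_inverse) (auto simp: clinear_iff)
  then have "dual_basis S e"
    by (auto simp: dual_basis_def \<open>finite S\<close> S cd.representation_basis[OF S(1)])
  then show ?thesis by blast
qed

text \<open>As \<partial> acts on functionals by -\<lambda>, one has f = \<Sum> q_s(\<partial>) e_s,
  where q_s is chosen with q_s(-\<lambda>) = f_\<lambda>(s).\<close>

lemma span_dual_basis:
  assumes "dual_basis S e"
  shows "cd.span (e ` S) = UNIV"
proof -
  have "f \<in> cd.span (e ` S)" for f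
  proof -
    have "\<exists>q. poly_act (- indet) q 1 = (p :: complex poly)" for p
    proof (induction p)
      case (pCons a p)
      then obtain q where q: "poly_act (- indet) q 1 = p" by blast
      \<comment> \<open>The sign of the tail is flipped at every degree, which builds p(-\<lambda>)
        from p.\<close>
      have "poly_act (- indet) (pCons a (- q)) 1 = pCons a p"
        by (simp add: poly_act_pCons[OF clinear_indet_partial(3)] q
            clinearD(4)[OF clinear_poly_act_left[OF clinear_indet_partial(3)]])
          (simp add: one_pCons scaleC_pCons scaleC_complex_def)
      then show ?case by blast
    qed (auto intro: exI[of _ 0])
    then obtain q where q: "\<And>p :: complex poly. poly_act (- indet) (q p) 1 = p" by metis
    have "f = (\<Sum>s\<in>S. dact (q (f \<cdot> s)) (e s))"
    proof (rule chom_eq_on_span)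
      fix t assume t: "t \<in> S"
      have "(\<Sum>s\<in>S. dact (q (f \<cdot> s)) (e s)) \<cdot> t = (\<Sum>s\<in>S. poly_act (- indet) (q (f \<cdot> s)) (e s \<cdot> t))"
        by (simp only: clinearD(6)[OF clinear_capp_left] capp_dact)
      also have "\<dots> = (\<Sum>s\<in>S. if s = t then f \<cdot> t else 0)"
        using assms t
        by (intro sum.cong) (auto simp: dual_basis_def q clinearD(3)[OF clinear_poly_act[OF clinear_indet_partial(3)]])
      also have "\<dots> = f \<cdot> t"
        using assms t by (simp add: dual_basis_def)
      finally show "f \<cdot> t = (\<Sum>s\<in>S. dact (q (f \<cdot> s)) (e s)) \<cdot> t" ..
    qed (use assms in \<open>simp add: dual_basis_def\<close>)
    also have "\<dots> \<in> cd.span (e ` S)"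
      by (intro cd.span_sum cd.span_scale cd.span_base) auto
    finally show ?thesis .
  qed
  then show ?thesis by auto
qed

text \<open>A Leibniz rule coming from -\<lambda> = -(\<lambda> + \<partial>) + \<partial>. The
  first term is \<partial> on the functional, which is evaluated at \<lambda> + \<partial>; the
  second is \<partial> on \<open>a\<close>.\<close>

lemma partial_rank_one: "\<partial> (rank_one f a) = rank_one (\<partial> f) a + rank_one f (\<partial> a)"
proof -
  note X = clinear_indet_partial(1)
  have "rank_one f (\<partial> a) \<cdot> v = \<partial> (rank_one f a \<cdot> v)" for v
    unfolding rank_one_app pCons_partial
    by (rule poly_act_comm[OF X X clinear_partial, symmetric]) (simp add: partial_add partial_indet)
  moreover have "rank_one (\<partial> f) a \<cdot> v = - (indet + \<partial>) (rank_one f a \<cdot> v)" for v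
    unfolding rank_one_app cpartial_chom.rep_eq clinearD(4)[OF clinear_poly_act_left[OF X]]
    by (simp add: poly_act_pCons[OF X])
  ultimately show ?thesis
    by (auto simp: capp_inject[symmetric] fun_eq_iff plus_chom.rep_eq cpartial_chom.rep_eq)
qed

text \<open>This makes \<open>inv chom_of_tensor T\<close> a genuine preimage of \<open>T\<close>.
  Conformal maps are determined on a basis, so it suffices to realise an arbitrary polynomial value
  at one basis vector together with 0 at the others.\<close>

lemma surj_chom_of_tensor:
  assumes "cd_finite TYPE('m::cd_module)" "cd_free TYPE('m)"
  shows "surj (chom_of_tensor :: _ \<Rightarrow> ('m, 'a::cd_module) chom)"
proof -
  let ?R = "range (chom_of_tensor :: _ \<Rightarrow> ('m, 'a) chom)"
  obtain S and e :: "'m \<Rightarrow> 'm cdual" where e: "dual_basis S e"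
    using dual_basis_exists[OF assms] by blast
  have lin: "clinear (chom_of_tensor :: _ \<Rightarrow> ('m, 'a) chom)"
    unfolding chom_of_tensor_def by (rule clinear_tensor_lift[OF cbilinear_rank_one])
  note sub = subspace_range[OF lin]
  have rank: "rank_one f a \<in> ?R" for f a
    using rangeI[of chom_of_tensor "f \<otimes> a"] by (simp only: chom_of_tensor_tensor)
  have R_partial: "\<partial> Y \<in> ?R" if "Y \<in> ?R" for Y
  proof -
    obtain t where "Y = chom_of_tensor t" using \<open>Y \<in> ?R\<close> by blast
    moreover have "\<partial> (chom_of_tensor t) \<in> ?R"
      by (induction t rule: tensor_induct)
        (auto simp: chom_of_tensor_tensor partial_rank_one partial_add clinearD(1)[OF lin]
          intro!: cvec.subspace_add[OF sub] rank)
    ultimately show ?thesis by simp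
  qed
  have "\<exists>Y\<in>?R. \<forall>s'\<in>S. Y \<cdot> s' = (if s = s' then P else 0)" if "s \<in> S" for s P
  proof (induction P)
    case 0
    show ?case by (rule bexI[OF _ cvec.subspace_0[OF sub]]) (simp add: zero_chom.rep_eq)
  next
    case (pCons a P)
    then obtain Y where Y: "Y \<in> ?R" "\<forall>s'\<in>S. Y \<cdot> s' = (if s = s' then P else 0)" by blast
    have "rank_one (e s) a \<cdot> s' = (if s = s' then [:a:] else 0)" if "s' \<in> S" for s'
      using e that \<open>s \<in> S\<close>
      by (auto simp: rank_one_app dual_basis_def one_pCons poly_act_pCons clinear_indet_partial(1) partial_indet
          clinearD(3)[OF clinear_partial])
    \<comment> \<open>The rank-one map supplies the constant term, and -\<partial> multiplies the
      values of \<open>Y\<close> by \<lambda>.\<close>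
    then show ?case
      using Y
      by (intro bexI[of _ "rank_one (e s) a - \<partial> Y"] cvec.subspace_diff[OF sub] rank R_partial)
        (auto simp: minus_chom.rep_eq cpartial_chom.rep_eq)
  qed
  then have "\<forall>s P. \<exists>Y. s \<in> S \<longrightarrow> Y \<in> ?R \<and> (\<forall>s'\<in>S. Y \<cdot> s' = (if s = s' then P else 0))" by blast
  then obtain Y where Y: "\<And>s P. s \<in> S \<Longrightarrow> Y s P \<in> ?R"
      "\<And>s P s'. s \<in> S \<Longrightarrow> s' \<in> S \<Longrightarrow> Y s P \<cdot> s' = (if s = s' then P else 0)"
    by metis
  have "T \<in> ?R" for T
  proof -
    have "T = (\<Sum>s\<in>S. Y s (T \<cdot> s))"
      by (rule chom_eq_on_span[of S])
        (use e in \<open>simp_all add: dual_basis_def clinearD(6)[OF clinear_capp_left] Y cong: sum.cong\<close>)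
    also have "\<dots> \<in> ?R"
      by (intro cvec.subspace_sum[OF sub] Y)
    finally show ?thesis .
  qed
  then show ?thesis by blast
qed

section \<open>Separating classes modulo \<open>\<partial>\<^sup>\<otimes>\<^sup>3\<close>\<close>

text \<open>On \<open>M\<^sup>* \<otimes> M\<^sup>* \<otimes> A\<close> this is \<open>f \<otimes> g \<otimes> a \<mapsto> f\<^bsub>-\<lambda>\<^esub>(u) g\<^bsub>\<lambda>+\<partial>\<^esub>(v) a\<close>; the total derivation acts
  through \<open>\<lambda> - (\<lambda> + \<partial>) + \<partial> = 0\<close>.\<close>

definition eval3 ::
    "'m::cd_module \<Rightarrow> 'm \<Rightarrow> (('a::cd_module \<times> 'm cdual, 'a \<times> 'm cdual) tensor, 'a \<times> 'm cdual) tensor \<Rightarrow> 'a poly" where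
  "eval3 u v = tensor3_lift (\<lambda>x y z.
     poly_act (- indet) (snd x \<cdot> u) (poly_act (indet + \<partial>) (snd y \<cdot> v) [:fst z:]))"

lemma
  shows clinear_eval3: "clinear (eval3 u v)"
    and eval3_tensor: "eval3 u v (x \<otimes> y \<otimes> z)
      = poly_act (- indet) (snd x \<cdot> u) (poly_act (indet + \<partial>) (snd y \<cdot> v) [:fst z:])"
proof -
  have s: "clinear (\<lambda>x. snd x \<cdot> u)" for u
    by (rule clinear_compose[OF clinear_capp_left clinear_snd])
  have f: "clinear (\<lambda>z. [:fst z:])"
    by (rule clinear_compose[OF clinear_const_poly clinear_fst])
  note X = clinear_indet_partial(1) and Y = clinear_indet_partial(3)
  note lin = clinear_compose[OF clinear_poly_act_left[OF Y] s]
    clinear_compose[OF clinear_poly_act[OF Y] clinear_compose[OF clinear_poly_act_left[OF X] s]]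
    clinear_compose[OF clinear_poly_act[OF Y] clinear_compose[OF clinear_poly_act[OF X] f]]
  show "clinear (eval3 u v)" "eval3 u v (x \<otimes> y \<otimes> z)
      = poly_act (- indet) (snd x \<cdot> u) (poly_act (indet + \<partial>) (snd y \<cdot> v) [:fst z:])"
    unfolding eval3_def by (rule clinear_tensor3_lift tensor3_lift_tensor; rule lin)+
qed

lemma poly_act_self_comm:
  assumes "clinear X" "clinear Z" "\<And>x. Z (X x) = X (Z x)"
  shows "poly_act X p (Z y) = Z (poly_act X p y)"
  by (rule poly_act_comm[OF assms(1,1,2,3), symmetric])

text \<open>On a functional evaluated at \<nu>, \<partial> acts as -\<nu>. The first factor has
  \<nu> = -\<lambda> and the second \<nu> = \<lambda> + \<partial>.\<close>

lemma eval3_d: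
  fixes t :: "(('a::cd_module \<times> 'm::cd_module cdual, 'a \<times> 'm cdual) tensor, 'a \<times> 'm cdual) tensor"
  shows "eval3 u v (d1 t) = indet (eval3 u v t)"
  "eval3 u v (d2 t) = - (indet + \<partial>) (eval3 u v t)"
  "eval3 u v (d3 t) = \<partial> (eval3 u v t)"
proof -
  note X = clinear_indet_partial(1) and Y = clinear_indet_partial(3)
  note X' = clinear_ops(3)[OF X]
  note neg = clinearD(4)[OF clinear_poly_act_left[OF X]] clinearD(4)[OF clinear_poly_act_left[OF Y]]
  show "eval3 u v (d1 t) = indet (eval3 u v t)"
    by (rule tensor3_eqI[OF clinear_compose[OF clinear_eval3 clinear_d(1)]
          clinear_compose[OF clinear_indet clinear_eval3]])
      (simp add: d_tensor eval3_tensor cpartial_prod_def cpartial_chom.rep_eq neg poly_act_pCons[OF Y])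
  have 1: "poly_act (- indet) p ((- (indet + \<partial>)) y) = (- (indet + \<partial>)) (poly_act (- indet) p y)"
    for p and y :: "'a poly"
    by (rule poly_act_self_comm[OF Y X'])
      (simp add: partial_indet clinearD[OF clinear_partial])
  have 2: "poly_act (indet + \<partial>) (- indet p) y = (- (indet + \<partial>)) (poly_act (indet + \<partial>) p y)"
    for p and y :: "'a poly"
    by (simp add: neg poly_act_pCons[OF X] clinearD[OF clinear_partial])
  have "eval3 u v (d2 t) = (- (indet + \<partial>)) (eval3 u v t)"
    by (rule tensor3_eqI[OF clinear_compose[OF clinear_eval3 clinear_d(2)]
          clinear_compose[OF X' clinear_eval3]])
      (simp only: d_tensor eval3_tensor cpartial_prod_def cpartial_chom.rep_eq snd_conv 1 2)
  then show "eval3 u v (d2 t) = - (indet + \<partial>) (eval3 u v t)"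
    by (simp only: fun_Compl_def)
  have 3: "poly_act (- indet) p (\<partial> y) = \<partial> (poly_act (- indet) p y)"
    "poly_act (indet + \<partial>) p (\<partial> y) = \<partial> (poly_act (indet + \<partial>) p y)"
    for p and y :: "'a poly"
    by (rule poly_act_self_comm[OF Y clinear_partial] poly_act_self_comm[OF X clinear_partial],
        simp add: partial_indet clinearD[OF clinear_partial])+
  show "eval3 u v (d3 t) = \<partial> (eval3 u v t)"
    by (rule tensor3_eqI[OF clinear_compose[OF clinear_eval3 clinear_d(3)]
          clinear_compose[OF clinear_partial clinear_eval3]])
      (simp only: d_tensor eval3_tensor cpartial_prod_def fst_conv 3 pCons_partial)
qed

lemma eval3_range_d_total: "t \<in> range d_total \<Longrightarrow> eval3 u v t = 0"
  by (erule rangeE) (simp add: clinearD(1)[OF clinear_eval3] eval3_d)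

section \<open>The subspace M^{*c} \<otimes> M^{*c} \<otimes> A\<close>

definition dual_dual_alg ::
    "(('a::cd_module \<times> 'm::cd_module cdual, 'a \<times> 'm cdual) tensor, 'a \<times> 'm cdual) tensor set" where
  "dual_dual_alg = cvec.span {(0, f) \<otimes> (0, g) \<otimes> (a, 0) | f g a. True}"

lemma subspace_dual_dual_alg: "cvec.subspace dual_dual_alg"
  unfolding dual_dual_alg_def by (rule cvec.subspace_span)

lemma dual_dual_alg_tensor: "(0, f) \<otimes> (0, g) \<otimes> (a, 0) \<in> dual_dual_alg"
  unfolding dual_dual_alg_def by (rule cvec.span_base) blast

lemma dual_dual_alg_induct:
  assumes "t \<in> dual_dual_alg" "cvec.subspace V" "\<And>f g a. (0, f) \<otimes> (0, g) \<otimes> (a, 0) \<in> V"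
  shows "t \<in> V"
proof -
  have "dual_dual_alg \<subseteq> V"
    unfolding dual_dual_alg_def by (rule cvec.span_minimal[OF _ assms(2)]) (auto simp: assms(3))
  then show ?thesis using assms(1) by (rule subsetD)
qed

lemma dual_dual_alg_d:
  assumes "t \<in> dual_dual_alg"
  shows "d1 t \<in> dual_dual_alg" "d2 t \<in> dual_dual_alg" "d3 t \<in> dual_dual_alg"
proof -
  have "t \<in> F -` dual_dual_alg"
    if "clinear F" "\<And>f g a. F ((0, f) \<otimes> (0, g) \<otimes> (a, 0)) \<in> dual_dual_alg" for F
    by (rule dual_dual_alg_induct[OF assms subspace_vimage[OF that(1) subspace_dual_dual_alg]]) (simp add: that(2))
  from this[OF clinear_d(1)] this[OF clinear_d(2)] this[OF clinear_d(3)]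
  show "d1 t \<in> dual_dual_alg" "d2 t \<in> dual_dual_alg" "d3 t \<in> dual_dual_alg"
    by (simp_all add: d_tensor cpartial_prod_def dual_dual_alg_tensor clinearD(3)[OF clinear_partial])
qed

text \<open>\<open>eval3\<close> reads the M^{*c}-components of the first two factors. After one or
  two rotations one of these factors lies in A.\<close>

lemma eval3_rot_dual_dual_alg:
  assumes "t \<in> dual_dual_alg"
  shows "eval3 u v (rot t) = 0" "eval3 u v (rot (rot t)) = 0"
proof -
  have ker: "cvec.subspace {t. F t = 0}" if "clinear F" for F
    using that by (auto simp: cvec.subspace_def clinearD)
  note Y = clinear_indet_partial(3)
  have "t \<in> {t. eval3 u v (rot t) = 0}"
    by (rule dual_dual_alg_induct[OF assms ker[OF clinear_compose[OF clinear_eval3 clinear_rot]]])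
      (simp add: rot_tensor eval3_tensor zero_chom.rep_eq)
  moreover have "t \<in> {t. eval3 u v (rot (rot t)) = 0}"
    by (rule dual_dual_alg_induct[OF assms ker[OF
            clinear_compose[OF clinear_eval3 clinear_compose[OF clinear_rot clinear_rot]]]])
      (simp add: rot_tensor eval3_tensor zero_chom.rep_eq clinearD(3)[OF clinear_poly_act[OF Y]])
  ultimately show "eval3 u v (rot t) = 0" "eval3 u v (rot (rot t)) = 0" by auto
qed

text \<open>Modulo \<open>\<partial>\<^sup>\<otimes>\<^sup>3\<close> an element of \<open>M\<^sup>* \<otimes> M\<^sup>* \<otimes> A\<close> can be rebuilt from its values on pairs of basis
  vectors, because \<open>\<partial>\<close> on the second factor can be moved to the other two.\<close>

lemma dual_dual_alg_separated:
  fixes e :: "'m::cd_module \<Rightarrow> 'm cdual"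
    and t :: "(('a::cd_module \<times> 'm cdual, 'a \<times> 'm cdual) tensor, 'a \<times> 'm cdual) tensor"
  assumes e: "dual_basis S e" and t: "t \<in> dual_dual_alg"
    and zero: "\<And>u v. eval3 u v t = 0"
  shows "t \<in> range d_total"
proof -
  define g where "g i j c = (0 :: 'a, e i) \<otimes> (0 :: 'a, e j) \<otimes> (c, 0 :: 'm cdual)" for i j and c :: 'a
  define R where "R i j = psubst d1 (g i j)" for i j
  \<comment> \<open>A candidate inverse of evaluation: the value p(\<lambda>) at a basis pair (i, j)
    is returned as e_i \<otimes> e_j \<otimes> p with \<lambda> replaced by \<open>d1\<close>. The
    set \<open>V\<close> collects the tensors it recovers modulo the total derivation.\<close>
  define \<Theta> where "\<Theta> s = (\<Sum>i\<in>S. \<Sum>j\<in>S. R i j (eval3 i j s))" for s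
  define V where "V = {s. s - \<Theta> s \<in> range d_total}"
  have g_lin: "clinear (g i j)" for i j
    unfolding g_def by (rule clinear_compose[OF clinear_tensor3(3) clinear_inl])
  have R_lin: "clinear (R i j)" for i j
    unfolding R_def by (rule clinear_psubst[OF clinear_d(1) g_lin])
  have R_indet: "R i j (indet p) = d1 (R i j p)" for i j p
    by (simp add: R_def psubst_pCons[OF clinear_d(1)] clinearD(3)[OF g_lin])
  have R_const: "R i j [:c:] = g i j c" for i j c
    by (simp add: R_def psubst_pCons[OF clinear_d(1)] clinearD(3)[OF g_lin] psubst_0 clinearD(3)[OF clinear_d(1)])
  have R_partial: "R i j (\<partial> p) = d3 (R i j p)" for i j p
  proof -
    have "R i j (\<partial> p) = psubst d1 (\<lambda>c. g i j (\<partial> c)) p"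
      unfolding R_def cpartial_poly_def
      by (rule psubst_map_poly[OF clinear_d(1)])
        (simp_all add: clinearD(3)[OF g_lin] clinearD(3)[OF clinear_partial])
    also have "(\<lambda>c. g i j (\<partial> c)) = (\<lambda>c. d3 (g i j c))"
      by (simp add: g_def d_tensor cpartial_prod_def clinearD(3)[OF clinear_partial])
    also have "psubst d1 (\<lambda>c. d3 (g i j c)) p = d3 (R i j p)"
      unfolding R_def
      by (rule psubst_comm[OF clinear_d(1) clinear_d(1) clinear_d(3), symmetric])
        (simp_all add: d_comm clinearD(3)[OF g_lin])
    finally show ?thesis .
  qed
  have \<Theta>_lin: "clinear \<Theta>"
    by (rule clinearI)
      (simp_all add: \<Theta>_def clinearD[OF clinear_eval3] clinearD[OF R_lin] sum.distrib cvec.scale_sum_right)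
  have \<Theta>_d1: "\<Theta> (d1 s) = d1 (\<Theta> s)" for s
    by (simp add: \<Theta>_def eval3_d R_indet clinearD(6)[OF clinear_d(1)])
  \<comment> \<open>Evaluation turns \<open>d2\<close> into -(\<lambda> + \<partial>), and
    \<open>\<Theta>\<close> returns \<lambda> and \<partial> as \<open>d1\<close> and
    \<open>d3\<close>.\<close>
  have \<Theta>_d2: "\<Theta> (d2 s) = - d1 (\<Theta> s) - d3 (\<Theta> s)" for s
    by (simp add: \<Theta>_def eval3_d clinearD(4,5)[OF R_lin] R_indet R_partial clinearD(4,6)[OF clinear_d(1)]
        clinearD(6)[OF clinear_d(3)] sum_negf sum_subtractf)
  note sub_D = subspace_range_d_total
  have V_sub: "cvec.subspace V"
  proof -
    have "clinear (\<lambda>s. s - \<Theta> s)"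
      by (simp add: clinear_iff clinearD[OF \<Theta>_lin] algebra_simps)
    from subspace_vimage[OF this sub_D] show ?thesis
      by (simp add: V_def vimage_def)
  qed
  have V_d1: "d1 s \<in> V" if s: "s \<in> V" for s
  proof -
    obtain z where "s - \<Theta> s = d_total z" using s unfolding V_def mem_Collect_eq by (rule rangeE)
    then have "d1 s - \<Theta> (d1 s) = d_total (d1 z)"
      by (simp only: \<Theta>_d1 clinearD(5)[OF clinear_d(1), symmetric] d_total_comm)
    then show ?thesis unfolding V_def by (simp only: mem_Collect_eq rangeI)
  qed
  have V_d2: "d2 s \<in> V" if s: "s \<in> V" for s
  proof -
    obtain z where "s - \<Theta> s = d_total z" using s unfolding V_def mem_Collect_eq by (rule rangeE)
    then have "d2 (s - \<Theta> s) = d_total (d2 z)"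
      by (simp only: d_total_comm)
    \<comment> \<open>Adding and subtracting \<open>d2 (\<Theta> s)\<close> completes the correction
      to the total derivation of \<open>\<Theta> s\<close>.\<close>
    moreover have "d2 s - \<Theta> (d2 s) = d2 (s - \<Theta> s) + d_total (\<Theta> s)"
      by (simp add: \<Theta>_d2 clinearD(5)[OF clinear_d(2)])
    ultimately have "d2 s - \<Theta> (d2 s) = d_total (d2 z) + d_total (\<Theta> s)"
      by (simp only:)
    also have "\<dots> = d_total (d2 z + \<Theta> s)"
      by (simp only: clinearD(1)[OF clinear_d_total])
    finally show ?thesis unfolding V_def by (simp only: mem_Collect_eq rangeI)
  qed
  \<comment> \<open>Only the pair i = k, j = l survives in the double sum, so
    \<open>\<Theta>\<close> fixes these tensors exactly.\<close>
  have V_basis: "(0, e k) \<otimes> (0, e l) \<otimes> (a, 0) \<in> V" if kl: "k \<in> S" "l \<in> S" for k l a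
  proof -
    note X = clinear_indet_partial(1) and Y = clinear_indet_partial(3)
    have "R i j (eval3 i j (g k l a)) = (if i = k then if j = l then g k l a else 0 else 0)"
      if "i \<in> S" "j \<in> S" for i j
      using e that kl
      by (auto simp: g_def[of k l] eval3_tensor dual_basis_def one_pCons poly_act_pCons[OF X] poly_act_pCons[OF Y]
          clinearD(3)[OF X] clinearD(3)[OF Y] clinearD(3)[OF R_lin] clinearD(3)[OF clinear_poly_act[OF Y]]
          clinearD(3)[OF clinear_partial] simp del: plus_fun_apply fun_Compl_def uminus_apply)
         (simp add: R_const g_def)
    then have "\<Theta> (g k l a) = (\<Sum>i\<in>S. \<Sum>j\<in>S. if i = k then if j = l then g k l a else 0 else 0)"
      unfolding \<Theta>_def by (intro sum.cong) auto
    also have "\<dots> = (\<Sum>i\<in>S. if i = k then \<Sum>j\<in>S. if j = l then g k l a else 0 else 0)"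
      by (intro sum.cong) auto
    also have "\<dots> = g k l a"
      using e kl by (simp add: dual_basis_def)
    finally show ?thesis
      using cvec.subspace_0[OF sub_D] by (simp add: V_def g_def)
  qed
  have comp: "clinear (\<lambda>f. (0, f) \<otimes> y \<otimes> z)" "clinear (\<lambda>f. x \<otimes> (0, f) \<otimes> z)"
    for x y z :: "'a \<times> 'm cdual"
    by (rule clinear_compose[OF clinear_tensor3(1) clinear_inr] clinear_compose[OF clinear_tensor3(2) clinear_inr])+
  \<comment> \<open>The basis functionals generate M^{*c} over C[\<partial>], so they are replaced
    by arbitrary functionals one factor at a time: \<partial> on the first factor is
    \<open>d1\<close>, and on the second, below, \<open>d2\<close>.\<close>
  have 1: "(0, f) \<otimes> (0, e l) \<otimes> (a, 0) \<in> V" if l: "l \<in> S" for f l a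
  proof -
    let ?W = "(\<lambda>f. (0, f) \<otimes> (0, e l) \<otimes> (a, 0)) -` V"
    have "cd.subspace ?W"
    proof (rule cd_subspaceI[OF subspace_vimage[OF comp(1) V_sub]])
      fix f assume "f \<in> ?W"
      then show "\<partial> f \<in> ?W"
        using V_d1[of "(0, f) \<otimes> (0, e l) \<otimes> (a, 0)"]
        by (simp add: d_tensor cpartial_prod_def clinearD(3)[OF clinear_partial])
    qed
    then have "cd.span (e ` S) \<subseteq> ?W"
      by (intro cd.span_minimal) (auto intro: V_basis l)
    then show ?thesis by (auto simp: span_dual_basis[OF e])
  qed
  have 2: "(0, f) \<otimes> (0, h) \<otimes> (a, 0) \<in> V" for f h a
  proof -
    let ?W = "(\<lambda>h. (0, f) \<otimes> (0, h) \<otimes> (a, 0)) -` V"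
    have "cd.subspace ?W"
    proof (rule cd_subspaceI[OF subspace_vimage[OF comp(2) V_sub]])
      fix h assume "h \<in> ?W"
      then show "\<partial> h \<in> ?W"
        using V_d2[of "(0, f) \<otimes> (0, h) \<otimes> (a, 0)"]
        by (simp add: d_tensor cpartial_prod_def clinearD(3)[OF clinear_partial])
    qed
    then have "cd.span (e ` S) \<subseteq> ?W"
      by (intro cd.span_minimal) (auto intro: 1)
    then show ?thesis by (auto simp: span_dual_basis[OF e])
  qed
  have "t \<in> V"
    by (rule dual_dual_alg_induct[OF t V_sub 2])
  moreover have "\<Theta> t = 0"
    by (simp add: \<Theta>_def zero clinearD(3)[OF R_lin])
  ultimately show ?thesis by (simp add: V_def)
qed

section \<open>The Yang-Baxter element and the O-operator identity\<close>

text \<open>Expanding over two copies of the index set gives twelve families of terms. Three contain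
  a product of two \<open>\<beta>\<close> and vanish; the other nine are the three rotations of each
  of \<open>W1\<close>, \<open>W2\<close> and \<open>W3\<close>. In the application the rotations
  inside \<open>Y\<close> bring the factor from A to the last place.\<close>

lemma bullet_antisymmetrized:
  fixes pr :: "'b::cd_module \<Rightarrow> 'b \<Rightarrow> 'b poly" and \<alpha> \<beta> :: "'i \<Rightarrow> 'b"
  assumes pr: "cbilinear pr" and "finite A" and zero: "\<And>p q. pr (\<beta> p) (\<beta> q) = 0"
  defines "Y \<equiv> \<Sum>p\<in>A. \<Sum>q\<in>A. third_slot (\<beta> p) (\<beta> q) (pr (\<alpha> p) (\<alpha> q))
      - rot (third_slot (\<beta> p) (\<alpha> q) (pr (\<alpha> p) (\<beta> q)))
      - rot (rot (third_slot (\<alpha> p) (\<beta> q) (pr (\<beta> p) (\<alpha> q))))"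
  shows "bullet pr ((\<Sum>p\<in>A. \<alpha> p \<otimes> \<beta> p) - (\<Sum>p\<in>A. \<beta> p \<otimes> \<alpha> p)) - (Y + rot Y + rot (rot Y))
    \<in> range d_total"
proof -
  \<comment> \<open>\<open>Inl\<close> indexes the summands of the tensor and \<open>Inr\<close>
    those of its negated flip, with the sign kept in the first factor.\<close>
  define s where "s = case_sum \<alpha> (\<lambda>p. - \<beta> p)"
  define t where "t = case_sum \<beta> \<alpha>"
  define G where "G i j = third_slot (s i) (s j) (pr (t i) (t j))
    - rot (rot (third_slot (t j) (s i) (pr (s j) (t i)))) + rot (third_slot (t i) (t j) (pr (s i) (s j)))" for i j
  define W1 where "W1 p q = third_slot (\<beta> p) (\<beta> q) (pr (\<alpha> p) (\<alpha> q))" for p q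
  define W2 where "W2 p q = third_slot (\<beta> p) (\<alpha> q) (pr (\<alpha> p) (\<beta> q))" for p q
  define W3 where "W3 p q = third_slot (\<alpha> p) (\<beta> q) (pr (\<beta> p) (\<alpha> q))" for p q
  note [simp] = clinearD[OF clinear_rot]
  have neg: "third_slot (- x) y P = - third_slot x y P" "third_slot x (- y) P = - third_slot x y P"
    "third_slot x y (- P) = - third_slot x y P" "third_slot x y 0 = 0" for x y :: 'b and P
    by (simp_all add: clinearD(4)[OF clinear_third_slot(2)] clinearD(4)[OF clinear_third_slot(3)]
        clinearD(3,4)[OF clinear_third_slot(1)])
  have pr_neg: "pr (- x) y = - pr x y" "pr x (- y) = - pr x y" for x y
    using pr by (auto simp: cbilinear_def intro: clinearD(4) clinearD(4)[where f = "\<lambda>x. pr x y"])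
  have G: "G (Inl p) (Inl q) = rot (W1 p q) - rot (rot (W2 q p))"
    "G (Inl p) (Inr q) = - W3 p q - rot (W2 p q)"
    "G (Inr p) (Inl q) = - W2 p q + rot (rot (W1 q p)) - rot (W3 p q)"
    "G (Inr p) (Inr q) = W1 p q - rot (rot (W3 q p))" for p q
    by (simp_all add: G_def s_def t_def W1_def W2_def W3_def neg pr_neg zero)
  let ?I = "A <+> A"
  have "(\<Sum>p\<in>A. \<alpha> p \<otimes> \<beta> p) - (\<Sum>p\<in>A. \<beta> p \<otimes> \<alpha> p) = (\<Sum>i\<in>?I. s i \<otimes> t i)"
    by (simp add: sum.Plus \<open>finite A\<close> s_def t_def clinearD(4)[OF clinear_tensor(1)] sum_negf)
  then have bullet: "bullet pr ((\<Sum>p\<in>A. \<alpha> p \<otimes> \<beta> p) - (\<Sum>p\<in>A. \<beta> p \<otimes> \<alpha> p))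
      = (\<Sum>i\<in>?I. \<Sum>j\<in>?I. bullet_term pr (s i) (t i) (s j) (t j))"
    by (simp only: bullet_sum[OF pr])
  define S where "S W = (\<Sum>p\<in>A. \<Sum>q\<in>A. W p q)" for W :: "'i \<Rightarrow> 'i \<Rightarrow> (('b, 'b) tensor, 'b) tensor"
  have swap: "(\<Sum>p\<in>A. \<Sum>q\<in>A. W q p) = S W" for W
    unfolding S_def by (rule sum.swap)
  have Y: "Y = S W1 - rot (S W2) - rot (rot (S W3))"
    by (simp add: Y_def S_def W1_def W2_def W3_def sum_subtractf)
  have "(\<Sum>i\<in>?I. \<Sum>j\<in>?I. G i j)
      = (\<Sum>p\<in>A. \<Sum>q\<in>A. G (Inl p) (Inl q)) + (\<Sum>p\<in>A. \<Sum>q\<in>A. G (Inl p) (Inr q))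
        + ((\<Sum>p\<in>A. \<Sum>q\<in>A. G (Inr p) (Inl q)) + (\<Sum>p\<in>A. \<Sum>q\<in>A. G (Inr p) (Inr q)))"
    by (simp add: sum.Plus \<open>finite A\<close> sum.distrib)
  also have "\<dots> = Y + rot Y + rot (rot Y)"
    unfolding G Y
    by (simp add: sum_subtractf sum.distrib sum_negf rot_rot_rot swap[of W1] swap[of W2] swap[of W3]
        S_def[of W1, symmetric] S_def[of W2, symmetric] S_def[of W3, symmetric]
        flip: clinearD(6)[OF clinear_rot])
  finally have sum_G: "(\<Sum>i\<in>?I. \<Sum>j\<in>?I. G i j) = Y + rot Y + rot (rot Y)" .
  have "(\<Sum>i\<in>?I. \<Sum>j\<in>?I. bullet_term pr (s i) (t i) (s j) (t j) - G i j) \<in> range d_total"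
    unfolding G_def by (intro cvec.subspace_sum[OF subspace_range_d_total] bullet_term_cyclic)
  then show ?thesis
    unfolding bullet sum_G[symmetric] by (simp only: sum_subtractf)
qed

section \<open>Commuting operators on A[\<lambda>]\<close>

lemma psubst_poly_act_pull_out:
  assumes "clinear X" "clinear Y" "clinear Z" "\<And>y. X (Y y) = Y (X y)" "\<And>c. clinear (\<lambda>c. G c)"
  shows "psubst Y (\<lambda>c. poly_act X p (G c)) P = poly_act X p (psubst Y G P)"
proof (rule psubst_comm[symmetric])
  show "poly_act X p (Y y) = Y (poly_act X p y)" for y
    using assms by (intro poly_act_self_comm) auto
qed (use assms clinear_poly_act clinearD(3) in auto)

lemma poly_act_swap:
  assumes "clinear X" "clinear Y" "\<And>y. X (Y y) = Y (X y)"
  shows "poly_act X p (poly_act Y q y) = poly_act Y q (poly_act X p y)"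
  using assms by (intro poly_act_self_comm[symmetric] clinear_poly_act poly_act_self_comm) auto

lemma indet_partial_comm:
  fixes y :: "'a::cd_module poly"
  shows "(- indet) ((indet + \<partial>) y) = (indet + \<partial>) ((- indet) y)"
    "(- indet - \<partial>) ((indet + \<partial>) y) = (indet + \<partial>) ((- indet - \<partial>) y)"
    "(- indet) ((- indet - \<partial>) y) = (- indet - \<partial>) ((- indet) y)"
    "\<partial> ((- indet) y) = (- indet) (\<partial> y)"
    "\<partial> ((- indet - \<partial>) y) = (- indet - \<partial>) (\<partial> y)"
  by (simp_all add: partial_indet clinearD[OF clinear_partial] algebra_simps)

lemma clinear_dact: "clinear (dact p)" "clinear (\<lambda>p. dact p a)"
  unfolding dact_eq_poly_act[abs_def]
  by (rule clinear_poly_act clinear_poly_act_left, rule clinear_partial)+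

text \<open>Since \<partial> is zero on C, w |-> f_\<partial>(w) a is compatible with \<partial>.
  The map T_0 is a sum of such maps.\<close>

lemma dact_capp_partial: "dact (f \<cdot> \<partial> w) a = \<partial> (dact (f \<cdot> w) a)" for f :: "'m::cd_module cdual"
  by (simp add: dact_eq_poly_act capp_partial partial_complex_poly poly_act_pCons clinear_partial)

lemma clinear_dact_capp: "clinear (\<lambda>w. dact (f \<cdot> w) a)"
  by (rule clinear_compose[OF clinear_dact(2) clinear_capp])

lemma map_poly_ops:
  assumes t: "clinear t" "\<And>w. t (\<partial> w) = \<partial> (t w)"
  shows "map_poly t (indet p) = indet (map_poly t p)" "map_poly t (\<partial> p) = \<partial> (map_poly t p)"
  by (auto simp: poly_eq_iff coeff_map_poly clinearD[OF t(1)] t(2) coeff_pCons split: nat.splits)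

section \<open>Evaluating the contragredient actions\<close>

text \<open>The contragredient identity with -\<lambda> - \<partial> for \<lambda> and -\<lambda>
  for \<mu>: the difference \<mu> - \<lambda> becomes \<partial>. It serves for
  \<open>r\<^sub>A\<close>, whose contragredient is the left action in the semi-direct
  product.\<close>

lemma cdual_map_eval_left:
  fixes x :: "'m::cd_module cend" and a :: "'a::cd_module"
  assumes dual: "is_cdual_map x x'"
  shows "psubst (- indet - \<partial>) (\<lambda>h. poly_act (- indet) (h \<cdot> u) [:a:]) (x' \<cdot> f)
    = map_poly (\<lambda>w. dact (f \<cdot> w) a) (at1 (- indet - \<partial>) (x \<cdot> u))"
proof -
  note t = clinear_dact_capp[of f a]
  have "(- indet - (- indet - \<partial>)) = (\<partial> :: 'a poly \<Rightarrow> _)"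
    by (simp add: fun_eq_iff)
  then have "psubst (- indet - \<partial>) (\<lambda>h. poly_act (- indet) (h \<cdot> u) [:a:]) (x' \<cdot> f)
      = psubst (- indet - \<partial>) (\<lambda>w. [:dact (f \<cdot> w) a:]) (x \<cdot> u)"
    using cdual_map_eval[OF dual clinear_indet_partial(2) clinear_indet_partial(3) indet_partial_comm(3)[symmetric],
        of u "[:a:]" f]
    by (simp only: poly_act_partial_const)
  also have "\<dots> = psubst (- indet - \<partial>) (\<lambda>w. map_poly (\<lambda>w. dact (f \<cdot> w) a) [:w:]) (x \<cdot> u)"
    by (simp add: map_poly_pCons clinearD(3)[OF t])
  also have "\<dots> = map_poly (\<lambda>w. dact (f \<cdot> w) a) (at1 (- indet - \<partial>) (x \<cdot> u))"
    by (rule psubst_comm[OF clinear_indet_partial(2) clinear_indet_partial(2) clinear_map_poly[OF t], symmetric])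
      (simp_all add: map_poly_ops[OF t dact_capp_partial] clinearD[OF clinear_map_poly[OF t]])
  finally show ?thesis .
qed

text \<open>The nested substitutions collapse: \<lambda> becomes \<partial>, while \<partial> on
  M^{*c} evaluates to -(\<lambda> + \<partial>), so -\<lambda> - \<partial> becomes -\<partial> +
  (\<lambda> + \<partial>) = \<lambda>. The contragredient identity at \<lambda> and \<mu> =
  \<lambda> + \<partial> then again leaves f evaluated at \<partial>.\<close>

lemma cdual_map_eval_right:
  fixes x :: "'m::cd_module cend" and a :: "'a::cd_module"
  assumes dual: "is_cdual_map x x'"
  shows "psubst \<partial> (\<lambda>h. poly_act (indet + \<partial>) (h \<cdot> v) [:a:]) (at1 (- indet - \<partial>) (x' \<cdot> f))
    = map_poly (\<lambda>w. dact (f \<cdot> w) a) (x \<cdot> v)"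
proof -
  note t = clinear_dact_capp[of f a] and X = clinear_indet_partial(1)
  define G where "G h = poly_act (indet + \<partial>) (h \<cdot> v) [:a:]" for h :: "'m cdual"
  have G: "clinear G"
    unfolding G_def[abs_def] by (rule clinear_compose[OF clinear_poly_act_left[OF X] clinear_capp_left])
  have G_partial: "G (\<partial> h) = - indet (G h) - \<partial> (G h)" for h
    by (simp add: G_def cpartial_chom.rep_eq clinearD(4)[OF clinear_poly_act_left[OF X]] poly_act_pCons[OF X]
        clinearD[OF clinear_partial])
  define Z where "Z = psubst \<partial> G"
  have Z: "clinear Z"
    unfolding Z_def by (rule clinear_psubst[OF clinear_partial G])
  have Z_indet: "Z (indet q) = \<partial> (Z q)" for q
    by (simp add: Z_def psubst_pCons[OF clinear_partial] clinearD(3)[OF G])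
  have Z_partial: "Z (\<partial> q) = (- indet - \<partial>) (Z q)" for q
  proof -
    have "Z (\<partial> q) = psubst \<partial> (\<lambda>h. G (\<partial> h)) q"
      using psubst_map_poly[OF clinear_partial, of G \<partial> q]
      by (simp add: Z_def cpartial_poly_def[where 'a = "'m cdual", symmetric] clinearD(3)[OF G]
          clinearD(3)[OF clinear_partial])
    also have "\<dots> = psubst \<partial> (\<lambda>h. (- indet - \<partial>) (G h)) q"
      by (simp add: G_partial)
    also have "\<dots> = (- indet - \<partial>) (Z q)"
      unfolding Z_def
      by (rule psubst_comm[OF clinear_partial clinear_partial clinear_indet_partial(2), symmetric])
        (rule indet_partial_comm(5)[symmetric], rule clinearD(3)[OF G])
    finally show ?thesis .
  qed
  have Z_const: "Z [:h:] = G h" for h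
    by (simp add: Z_def psubst_pCons[OF clinear_partial] clinearD(3)[OF G] psubst_0 clinearD(3)[OF clinear_partial])
  have "Z (at1 (- indet - \<partial>) (x' \<cdot> f)) = psubst indet (\<lambda>h. Z [:h:]) (x' \<cdot> f)"
    by (rule psubst_comm[OF clinear_indet_partial(2) clinear_indet Z])
      (simp_all add: clinearD(4,5)[OF Z] Z_indet Z_partial clinearD[OF clinear_partial])
  also have "\<dots> = psubst indet (\<lambda>w. poly_act (indet + \<partial> - indet) (f \<cdot> w) [:a:]) (x \<cdot> v)"
    unfolding Z_const G_def
    by (rule cdual_map_eval[OF dual clinear_indet X]) (simp add: partial_indet)
  also have "indet + \<partial> - indet = (\<partial> :: 'a poly \<Rightarrow> _)"
    by (simp add: fun_eq_iff)
  also have "psubst indet (\<lambda>w. poly_act \<partial> (f \<cdot> w) [:a:]) (x \<cdot> v)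
      = at1 indet (map_poly (\<lambda>w. dact (f \<cdot> w) a) (x \<cdot> v))"
    unfolding poly_act_partial_const
    by (rule psubst_map_poly[OF clinear_indet, symmetric]) (simp_all add: clinearD(3)[OF t])
  finally show ?thesis
    by (simp only: at1_indet Z_def G_def[abs_def])
qed

section \<open>Products in the semi-direct product and their evaluation\<close>

lemma cbilinear_semidirect:
  assumes "cbilinear pr" "clinear l" "clinear r"
  shows "cbilinear (semidirect pr l r)"
proof -
  have pr: "clinear (pr a)" "clinear (\<lambda>a. pr a b)" for a b
    using assms(1) by (auto simp: cbilinear_def)
  note at1 = clinear_psubst[OF clinear_indet_partial(2) clinear_const_poly]
  note [simp] = clinearD[OF at1] clinearD[OF clinear_map_poly[OF clinear_inl]]
    clinearD[OF clinear_map_poly[OF clinear_inr]] clinearD[OF pr(1)] clinearD[OF pr(2)]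
    clinearD[OF assms(2)] clinearD[OF assms(3)] clinearD[OF clinear_capp]
    plus_chom.rep_eq scaleC_chom.rep_eq
  show ?thesis
    by (intro cbilinearI clinearI)
      (auto simp: semidirect_def scaleC_prod_def algebra_simps)
qed

lemma semidirect_simps:
  assumes "cbilinear pr" "clinear l" "clinear r"
  shows "semidirect pr l r (a, 0) (b, 0) = map_poly (\<lambda>c. (c, 0)) (pr a b)"
    "semidirect pr l r (a, 0) (0, y) = map_poly (\<lambda>z. (0, z)) (l a \<cdot> y)"
    "semidirect pr l r (0, x) (b, 0) = map_poly (\<lambda>z. (0, z)) (at1 (- indet - \<partial>) (r b \<cdot> x))"
    "semidirect pr l r (0, x) (0, y) = 0"
proof -
  have pr: "clinear (pr a)" "clinear (\<lambda>a. pr a b)" for a b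
    using assms(1) by (auto simp: cbilinear_def)
  note [simp] = clinearD(3)[OF pr(1)] clinearD(3)[OF pr(2)] clinearD(3)[OF assms(2)]
    clinearD(3)[OF assms(3)] clinearD(3)[OF clinear_capp] zero_chom.rep_eq psubst_0
  show "semidirect pr l r (a, 0) (b, 0) = map_poly (\<lambda>c. (c, 0)) (pr a b)"
    "semidirect pr l r (a, 0) (0, y) = map_poly (\<lambda>z. (0, z)) (l a \<cdot> y)"
    "semidirect pr l r (0, x) (b, 0) = map_poly (\<lambda>z. (0, z)) (at1 (- indet - \<partial>) (r b \<cdot> x))"
    "semidirect pr l r (0, x) (0, y) = 0"
    by (simp_all add: semidirect_def)
qed

text \<open>These are the three kinds of terms of \<open>Y\<close>. The operators \<open>d1\<close>,
  \<open>d2\<close>, \<open>d3\<close> preserve the subspace, hence so do substitutions of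
  them.\<close>

lemma slots_dual_dual_alg:
  "third_slot (0, f) (0, g) (map_poly (\<lambda>c. (c, 0)) P) \<in> dual_dual_alg"
  "rot (third_slot (0, f) (a, 0) (map_poly (\<lambda>h. (0, h)) H)) \<in> dual_dual_alg"
  "rot (rot (third_slot (a, 0) (0, f) (map_poly (\<lambda>h. (0, h)) H))) \<in> dual_dual_alg"
proof -
  show "third_slot (0, f) (0, g) (map_poly (\<lambda>c. (c, 0)) P) \<in> dual_dual_alg"
    unfolding third_slot_def
    by (rule psubst_mem_subspace[OF subspace_dual_dual_alg dual_dual_alg_d(1)])
      (simp_all add: coeff_map_poly dual_dual_alg_tensor flip: zero_prod_def)
  show "rot (third_slot (0, f) (a, 0) (map_poly (\<lambda>h. (0, h)) H)) \<in> dual_dual_alg"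
    unfolding rot_third_slot(1)
    by (rule psubst_mem_subspace[OF subspace_dual_dual_alg dual_dual_alg_d(2)])
      (simp_all add: coeff_map_poly dual_dual_alg_tensor flip: zero_prod_def)
  show "rot (rot (third_slot (a, 0) (0, f) (map_poly (\<lambda>h. (0, h)) H))) \<in> dual_dual_alg"
    unfolding rot_third_slot(2)
    by (rule psubst_mem_subspace[OF subspace_dual_dual_alg dual_dual_alg_d(3)])
      (simp_all add: coeff_map_poly dual_dual_alg_tensor flip: zero_prod_def)
qed

text \<open>\<open>eval3\<close> turns substitution of \<open>d1\<close>, \<open>d2\<close>,
  \<open>d3\<close> into substitution of \<lambda>, -\<lambda> - \<partial>, \<partial>. Functionals
  outside the product act by operators commuting with these and are pulled out.\<close>

lemma eval3_slots:
  "eval3 u v (third_slot (0, f) (0, g) (map_poly (\<lambda>c. (c, 0)) P))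
    = poly_act (- indet) (f \<cdot> u) (poly_act (indet + \<partial>) (g \<cdot> v) P)"
  "eval3 u v (rot (third_slot (0, f) (a, 0) (map_poly (\<lambda>h. (0, h)) H)))
    = poly_act (indet + \<partial>) (f \<cdot> v) (psubst (- indet - \<partial>) (\<lambda>h. poly_act (- indet) (h \<cdot> u) [:a:]) H)"
  "eval3 u v (rot (rot (third_slot (a, 0) (0, f) (map_poly (\<lambda>h. (0, h)) H))))
    = poly_act (- indet) (f \<cdot> u) (psubst \<partial> (\<lambda>h. poly_act (indet + \<partial>) (h \<cdot> v) [:a:]) H)"
proof -
  note X = clinear_indet_partial(1) and Y = clinear_indet_partial(3)
  note E = clinear_eval3[of u v]
  have "eval3 u v (third_slot (0, f) (0, g) (map_poly (\<lambda>c. (c, 0)) P))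
      = psubst indet (\<lambda>z. eval3 u v ((0, f) \<otimes> (0, g) \<otimes> z)) (map_poly (\<lambda>c. (c, 0)) P)"
    unfolding third_slot_def
    by (rule psubst_comm[OF clinear_d(1) clinear_indet E]) (auto simp: eval3_d clinearD(3)[OF clinear_tensor3(3)])
  also have "\<dots> = psubst indet (\<lambda>c. poly_act (- indet) (f \<cdot> u) (poly_act (indet + \<partial>) (g \<cdot> v) [:c:])) P"
    by (subst psubst_map_poly[OF clinear_indet])
      (simp_all add: eval3_tensor clinearD(3)[OF clinear_poly_act[OF X]] clinearD(3)[OF clinear_poly_act[OF Y]]
        clinearD(3)[OF clinear_tensor3(3)] clinearD(3)[OF E] flip: zero_prod_def)
  also have "\<dots> = poly_act (- indet) (f \<cdot> u) (psubst indet (\<lambda>c. poly_act (indet + \<partial>) (g \<cdot> v) [:c:]) P)"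
    by (rule psubst_poly_act_pull_out[OF Y clinear_indet Y _
          clinear_compose[OF clinear_poly_act[OF X] clinear_const_poly]]) simp
  also have "psubst indet (\<lambda>c. poly_act (indet + \<partial>) (g \<cdot> v) [:c:]) P = poly_act (indet + \<partial>) (g \<cdot> v) (at1 indet P)"
    by (rule psubst_poly_act_pull_out[OF X clinear_indet X _ clinear_const_poly]) (simp add: partial_indet)
  finally show "eval3 u v (third_slot (0, f) (0, g) (map_poly (\<lambda>c. (c, 0)) P))
      = poly_act (- indet) (f \<cdot> u) (poly_act (indet + \<partial>) (g \<cdot> v) P)"
    unfolding at1_indet .
next
  note X = clinear_indet_partial(1) and Y = clinear_indet_partial(3) and W = clinear_indet_partial(2)
  note E = clinear_eval3[of u v]
  have "eval3 u v (rot (third_slot (0, f) (a, 0) (map_poly (\<lambda>h. (0, h)) H)))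
      = psubst (- indet - \<partial>) (\<lambda>z. eval3 u v (z \<otimes> (0, f) \<otimes> (a, 0))) (map_poly (\<lambda>h. (0, h)) H)"
    unfolding rot_third_slot(1)
    by (rule psubst_comm[OF clinear_d(2) W E]) (auto simp: eval3_d clinearD(3)[OF clinear_tensor3(1)])
  also have "\<dots> = psubst (- indet - \<partial>)
      (\<lambda>h. poly_act (- indet) (h \<cdot> u) (poly_act (indet + \<partial>) (f \<cdot> v) [:a:])) H"
    by (subst psubst_map_poly[OF W])
      (simp_all add: eval3_tensor clinearD(3)[OF clinear_tensor3(1)] clinearD(3)[OF E] flip: zero_prod_def)
  also have "\<dots> = psubst (- indet - \<partial>)
      (\<lambda>h. poly_act (indet + \<partial>) (f \<cdot> v) (poly_act (- indet) (h \<cdot> u) [:a:])) H"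
    by (simp only: poly_act_swap[OF Y X indet_partial_comm(1)])
  also have "\<dots> = poly_act (indet + \<partial>) (f \<cdot> v)
      (psubst (- indet - \<partial>) (\<lambda>h. poly_act (- indet) (h \<cdot> u) [:a:]) H)"
    by (rule psubst_poly_act_pull_out[OF X W W indet_partial_comm(2)[symmetric]
          clinear_compose[OF clinear_poly_act_left[OF Y] clinear_capp_left]])
  finally show "eval3 u v (rot (third_slot (0, f) (a, 0) (map_poly (\<lambda>h. (0, h)) H)))
    = poly_act (indet + \<partial>) (f \<cdot> v) (psubst (- indet - \<partial>) (\<lambda>h. poly_act (- indet) (h \<cdot> u) [:a:]) H)" .
next
  note X = clinear_indet_partial(1) and Y = clinear_indet_partial(3)
  note E = clinear_eval3[of u v]
  have "eval3 u v (rot (rot (third_slot (a, 0) (0, f) (map_poly (\<lambda>h. (0, h)) H))))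
      = psubst \<partial> (\<lambda>z. eval3 u v ((0, f) \<otimes> z \<otimes> (a, 0))) (map_poly (\<lambda>h. (0, h)) H)"
    unfolding rot_third_slot(2)
    by (rule psubst_comm[OF clinear_d(3) clinear_partial E]) (auto simp: eval3_d clinearD(3)[OF clinear_tensor3(2)])
  also have "\<dots> = psubst \<partial> (\<lambda>h. poly_act (- indet) (f \<cdot> u) (poly_act (indet + \<partial>) (h \<cdot> v) [:a:])) H"
    by (subst psubst_map_poly[OF clinear_partial])
      (simp_all add: eval3_tensor clinearD(3)[OF clinear_tensor3(2)] clinearD(3)[OF E] flip: zero_prod_def)
  also have "\<dots> = poly_act (- indet) (f \<cdot> u) (psubst \<partial> (\<lambda>h. poly_act (indet + \<partial>) (h \<cdot> v) [:a:]) H)"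
    by (rule psubst_poly_act_pull_out[OF Y clinear_partial clinear_partial indet_partial_comm(4)[symmetric]
          clinear_compose[OF clinear_poly_act_left[OF X] clinear_capp_left]])
  finally show "eval3 u v (rot (rot (third_slot (a, 0) (0, f) (map_poly (\<lambda>h. (0, h)) H))))
    = poly_act (- indet) (f \<cdot> u) (psubst \<partial> (\<lambda>h. poly_act (indet + \<partial>) (h \<cdot> v) [:a:]) H)" .
qed

section \<open>Moving polynomials in \<partial> through products and actions\<close>

lemma conformal_algebra_poly_act:
  assumes "assoc_conformal_algebra pr"
  shows "pr (dact p a) b = poly_act (- indet) p (pr a b)"
    "pr a (dact p b) = poly_act (indet + \<partial>) p (pr a b)"
proof -
  interpret assoc_conformal_algebra pr by fact
  show "pr (dact p a) b = poly_act (- indet) p (pr a b)"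
    unfolding dact_eq_poly_act
    by (rule poly_act_comm[OF clinear_partial clinear_indet_partial(3) linear_left]) (simp add: sesqui_left)
  show "pr a (dact p b) = poly_act (indet + \<partial>) p (pr a b)"
    unfolding dact_eq_poly_act
    by (rule poly_act_comm[OF clinear_partial clinear_indet_partial(1) linear_right]) (simp add: sesqui_right)
qed

lemma cd_hom_dact: "cd_hom l \<Longrightarrow> l (dact p a) = dact p (l a)"
  unfolding dact_eq_poly_act cd_hom_def
  by (rule poly_act_comm) (auto simp: clinear_partial)

text \<open>At \<lambda> = 0 the operator \<partial> + \<lambda> is \<partial>. This supplies the
  homomorphism clause of \<open>o_operator\<close>.\<close>

lemma cd_hom_coeff_0: "cd_hom (\<lambda>u. coeff (T \<cdot> u) 0)"
  by (auto simp: cd_hom_def clinear_iff capp_partial clinearD[OF clinear_capp])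

text \<open>Replacing \<lambda> by -\<lambda> - \<partial> turns -\<lambda> into \<lambda> +
  \<partial>, so the right action obeys the same rule as the second argument of the product.\<close>

lemma at1_poly_act:
  "at1 (- indet - \<partial>) (poly_act (- indet) p w) = poly_act (indet + \<partial>) p (at1 (- indet - \<partial>) w)"
proof (rule poly_act_comm[OF clinear_indet_partial(3,1)])
  note W = clinear_indet_partial(2)
  show lin: "clinear (at1 (- indet - \<partial>))"
    by (rule clinear_psubst[OF W clinear_const_poly])
  show "at1 (- indet - \<partial>) ((- indet) q) = (indet + \<partial>) (at1 (- indet - \<partial>) q)" for q
    using clinearD(4)[OF lin, of "indet q"] by (simp add: psubst_pCons[OF W])
qed

section \<open>Equivalence of the Yang-Baxter equation with the O-operator identity\<close>

theorem theorem6p7: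
  fixes pr :: "'a::cd_module \<Rightarrow> 'a \<Rightarrow> 'a poly"
    and l\<^sub>A r\<^sub>A :: "'a \<Rightarrow> 'm::cd_module cend"
    and T :: "('m, 'a) chom"
  assumes "assoc_conformal_algebra pr"
    and "cd_finite TYPE('a)"
    and "conformal_bimodule pr l\<^sub>A r\<^sub>A"
    and "cd_finite TYPE('m)"
    and "cd_free TYPE('a)"
    and "cd_free TYPE('m)"
  defines "r\<^sub>T \<equiv> tensor_map (\<lambda>a. (a, 0)) (\<lambda>f. (0, f)) (tensor_of_chom T)"
  shows "antisymmetric (r\<^sub>T - tensor_flip r\<^sub>T)
      \<and> conformal_ybe (semidirect pr (cdual_rep r\<^sub>A) (cdual_rep l\<^sub>A)) (r\<^sub>T - tensor_flip r\<^sub>T)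
    \<longleftrightarrow> o_operator pr l\<^sub>A r\<^sub>A (\<lambda>u. coeff (T \<cdot> u) 0)"
proof -
  interpret bimod: conformal_bimodule pr l\<^sub>A r\<^sub>A by fact
  have pr: "cbilinear pr"
    using assms(1) by (simp add: cbilinear_def assoc_conformal_algebra_def)
  have lr: "clinear l\<^sub>A" "clinear r\<^sub>A"
    using bimod.hom_l bimod.hom_r by (simp_all add: cd_hom_def)
  note dual = cdual_rep[OF assms(4)]
  note sd = semidirect_simps[OF pr clinear_cdual_rep[OF assms(4) lr(2)] clinear_cdual_rep[OF assms(4) lr(1)]]
  let ?pr = "semidirect pr (cdual_rep r\<^sub>A) (cdual_rep l\<^sub>A)"
  have sd_lin: "cbilinear ?pr"
    by (intro cbilinear_semidirect pr clinear_cdual_rep assms(4) lr)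
  obtain n :: nat and f a where t: "inv chom_of_tensor T = (\<Sum>p<n. f p \<otimes> a p)"
    by (rule tensor_eq_sum)
  define \<alpha> where "\<alpha> p = (a p, 0 :: 'm cdual)" for p
  define \<beta> where "\<beta> p = (0 :: 'a, f p)" for p
  define T0 where "T0 u = coeff (T \<cdot> u) 0" for u
  define Y where "Y = (\<Sum>p<n. \<Sum>q<n. third_slot (\<beta> p) (\<beta> q) (?pr (\<alpha> p) (\<alpha> q))
      - rot (third_slot (\<beta> p) (\<alpha> q) (?pr (\<alpha> p) (\<beta> q)))
      - rot (rot (third_slot (\<alpha> p) (\<beta> q) (?pr (\<beta> p) (\<alpha> q)))))"
  have "T = chom_of_tensor (\<Sum>p<n. f p \<otimes> a p)"
    using surj_f_inv_f[OF surj_chom_of_tensor[OF assms(4,6)], of T] by (simp add: t)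
  then have "T = (\<Sum>p<n. rank_one (f p) (a p))"
    by (simp only: chom_of_tensor_def clinearD(6)[OF clinear_tensor_lift[OF cbilinear_rank_one]]
        tensor_lift_tensor[OF cbilinear_rank_one])
  then have T0: "T0 u = (\<Sum>p<n. dact (f p \<cdot> u) (a p))" for u
    by (simp add: T0_def clinearD(6)[OF clinear_capp_left] coeff_sum coeff_0_rank_one)
  have T0_hom: "cd_hom T0"
    unfolding T0_def[abs_def] by (rule cd_hom_coeff_0)
  then have T0_lin: "clinear T0" and T0_partial: "T0 (\<partial> w) = \<partial> (T0 w)" for w
    by (auto simp: cd_hom_def)
  note map_T0 = map_poly_ops[OF T0_lin T0_partial] and map_T0_lin = clinear_map_poly[OF T0_lin]
  have "r\<^sub>T = (\<Sum>p<n. \<alpha> p \<otimes> \<beta> p)"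
    by (simp add: r\<^sub>T_def tensor_of_chom_def t clinearD(6)[OF clinear_tensor_flip] tensor_flip_tensor
        clinearD(6)[OF clinear_tensor_map[OF clinear_inl clinear_inr]]
        tensor_map_tensor[OF clinear_inl clinear_inr] \<alpha>_def \<beta>_def)
  then have r: "r\<^sub>T - tensor_flip r\<^sub>T = (\<Sum>p<n. \<alpha> p \<otimes> \<beta> p) - (\<Sum>p<n. \<beta> p \<otimes> \<alpha> p)"
    by (simp add: clinearD(6)[OF clinear_tensor_flip] tensor_flip_tensor)
  have bullet: "bullet ?pr (r\<^sub>T - tensor_flip r\<^sub>T) - (Y + rot Y + rot (rot Y)) \<in> range d_total"
    unfolding r Y_def
    by (rule bullet_antisymmetrized[OF sd_lin]) (simp_all add: \<beta>_def sd(4))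
  have Y_mem: "Y \<in> dual_dual_alg"
    unfolding Y_def \<alpha>_def \<beta>_def sd
    by (intro cvec.subspace_sum cvec.subspace_diff subspace_dual_dual_alg slots_dual_dual_alg)
  have map_T0_eq: "map_poly T0 w = (\<Sum>p<n. map_poly (\<lambda>w. dact (f p \<cdot> w) (a p)) w)" for w
    by (simp add: poly_eq_iff coeff_map_poly coeff_sum T0 clinearD(3)[OF clinear_dact_capp])
  have pa: "poly_act X p (sum g S) = (\<Sum>s\<in>S. poly_act X p (g s))" if "clinear X"
    for X :: "'a poly \<Rightarrow> 'a poly" and p and g :: "nat \<Rightarrow> 'a poly" and S
    by (rule clinearD(6)[OF clinear_poly_act[OF that]])
  note neg = clinear_indet_partial(3) and pos = clinear_indet_partial(1)
  \<comment> \<open>Products of two \<open>\<alpha>\<close> give the product of T_0-values. Products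
    of \<open>\<alpha>\<close> with \<open>\<beta>\<close> carry the contragredient of
    \<open>r\<^sub>A\<close> and give the right action term; products of \<open>\<beta>\<close> with
    \<open>\<alpha>\<close> carry that of \<open>l\<^sub>A\<close> and give the left one.\<close>
  have eval_Y: "eval3 u v Y = pr (T0 u) (T0 v) - map_poly T0 (l\<^sub>A (T0 u) \<cdot> v)
      - map_poly T0 (at1 (- indet - \<partial>) (r\<^sub>A (T0 v) \<cdot> u))" for u v
  proof -
    have prod: "pr (T0 u) (T0 v)
        = (\<Sum>p<n. \<Sum>q<n. poly_act (- indet) (f p \<cdot> u) (poly_act (indet + \<partial>) (f q \<cdot> v) (pr (a p) (a q))))"
    proof -
      have lin: "clinear (\<lambda>x. pr x y)" "clinear (pr x)" for x y
        using pr by (auto simp: cbilinear_def)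
      have 1: "pr (T0 u) y = (\<Sum>p<n. poly_act (- indet) (f p \<cdot> u) (pr (a p) y))" for y
        by (simp only: T0 clinearD(6)[OF lin(1)] conformal_algebra_poly_act(1)[OF assms(1)])
      have 2: "pr x (T0 v) = (\<Sum>q<n. poly_act (indet + \<partial>) (f q \<cdot> v) (pr x (a q)))" for x
        by (simp only: T0 clinearD(6)[OF lin(2)] conformal_algebra_poly_act(2)[OF assms(1)])
      show ?thesis
        unfolding 1 unfolding 2 pa[OF neg] ..
    qed
    have left: "map_poly T0 (l\<^sub>A (T0 u) \<cdot> v)
        = (\<Sum>p<n. \<Sum>q<n. poly_act (- indet) (f q \<cdot> u) (map_poly (\<lambda>w. dact (f p \<cdot> w) (a p)) (l\<^sub>A (a q) \<cdot> v)))"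
    proof -
      have "map_poly T0 (poly_act (- indet) p w) = poly_act (- indet) p (map_poly T0 w)" for p w
        by (rule poly_act_comm[OF neg neg map_T0_lin])
          (simp add: map_T0 clinearD(4)[OF map_T0_lin] del: minus_pCons)
      moreover have "l\<^sub>A (T0 u) \<cdot> v = (\<Sum>q<n. poly_act (- indet) (f q \<cdot> u) (l\<^sub>A (a q) \<cdot> v))"
        by (simp only: T0 clinearD(6)[OF lr(1)] clinearD(6)[OF clinear_capp_left] cd_hom_dact[OF bimod.hom_l]
            capp_dact)
      ultimately have "map_poly T0 (l\<^sub>A (T0 u) \<cdot> v)
          = (\<Sum>q<n. \<Sum>p<n. poly_act (- indet) (f q \<cdot> u) (map_poly (\<lambda>w. dact (f p \<cdot> w) (a p)) (l\<^sub>A (a q) \<cdot> v)))"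
        by (simp only: clinearD(6)[OF map_T0_lin]) (simp only: map_T0_eq pa[OF neg])
      \<comment> \<open>The order of summation is changed to match the indices in
        \<open>Y\<close>.\<close>
      also have "\<dots> = (\<Sum>p<n. \<Sum>q<n. poly_act (- indet) (f q \<cdot> u)
          (map_poly (\<lambda>w. dact (f p \<cdot> w) (a p)) (l\<^sub>A (a q) \<cdot> v)))"
        by (rule sum.swap)
      finally show ?thesis .
    qed
    have right: "map_poly T0 (at1 (- indet - \<partial>) (r\<^sub>A (T0 v) \<cdot> u))
        = (\<Sum>p<n. \<Sum>q<n. poly_act (indet + \<partial>) (f p \<cdot> v)
            (map_poly (\<lambda>w. dact (f q \<cdot> w) (a q)) (at1 (- indet - \<partial>) (r\<^sub>A (a p) \<cdot> u))))"
    proof -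
      have "map_poly T0 (poly_act (indet + \<partial>) p w) = poly_act (indet + \<partial>) p (map_poly T0 w)" for p w
        by (rule poly_act_comm[OF pos pos map_T0_lin]) (simp add: map_T0 clinearD(1)[OF map_T0_lin])
      moreover have "at1 (- indet - \<partial>) (r\<^sub>A (T0 v) \<cdot> u)
          = (\<Sum>p<n. poly_act (indet + \<partial>) (f p \<cdot> v) (at1 (- indet - \<partial>) (r\<^sub>A (a p) \<cdot> u)))"
        by (simp only: T0 clinearD(6)[OF lr(2)] clinearD(6)[OF clinear_capp_left] cd_hom_dact[OF bimod.hom_r]
            capp_dact clinearD(6)[OF clinear_psubst[OF clinear_indet_partial(2) clinear_const_poly]] at1_poly_act)
      ultimately show ?thesis
        by (simp only: clinearD(6)[OF map_T0_lin]) (simp only: map_T0_eq pa[OF pos])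
    qed
    have "eval3 u v Y = (\<Sum>p<n. \<Sum>q<n.
        poly_act (- indet) (f p \<cdot> u) (poly_act (indet + \<partial>) (f q \<cdot> v) (pr (a p) (a q)))
        - poly_act (indet + \<partial>) (f p \<cdot> v)
            (map_poly (\<lambda>w. dact (f q \<cdot> w) (a q)) (at1 (- indet - \<partial>) (r\<^sub>A (a p) \<cdot> u)))
        - poly_act (- indet) (f q \<cdot> u) (map_poly (\<lambda>w. dact (f p \<cdot> w) (a p)) (l\<^sub>A (a q) \<cdot> v)))"
      unfolding Y_def \<alpha>_def \<beta>_def sd clinearD(6)[OF clinear_eval3] clinearD(5)[OF clinear_eval3] eval3_slots
        cdual_map_eval_left[OF dual] cdual_map_eval_right[OF dual] ..
    then show ?thesis
      unfolding prod left right sum_subtractf by simp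
  qed
  have "conformal_ybe ?pr (r\<^sub>T - tensor_flip r\<^sub>T) \<longleftrightarrow> (\<forall>u v. eval3 u v Y = 0)"
  proof
    assume "conformal_ybe ?pr (r\<^sub>T - tensor_flip r\<^sub>T)"
    then have "bullet ?pr (r\<^sub>T - tensor_flip r\<^sub>T) \<in> range d_total"
      by (simp only: conformal_ybe_def)
    from cvec.subspace_diff[OF subspace_range_d_total this bullet]
    have "Y + rot Y + rot (rot Y) \<in> range d_total"
      by (simp only: diff_diff_eq2 add_diff_cancel_left')
    then have "eval3 u v (Y + rot Y + rot (rot Y)) = 0" for u v
      by (rule eval3_range_d_total)
    \<comment> \<open>The two rotated summands evaluate to zero because \<open>Y\<close> lies in
      \<open>dual_dual_alg\<close>.\<close>
    then show "\<forall>u v. eval3 u v Y = 0"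
      by (simp add: clinearD(1)[OF clinear_eval3] eval3_rot_dual_dual_alg[OF Y_mem])
  next
    assume zero: "\<forall>u v. eval3 u v Y = 0"
    obtain S and e :: "'m \<Rightarrow> 'm cdual" where "dual_basis S e"
      using dual_basis_exists[OF assms(4,6)] by blast
    then have Y: "Y \<in> range d_total"
      by (rule dual_dual_alg_separated[OF _ Y_mem]) (simp add: zero)
    \<comment> \<open>Rotation commutes with the total derivation, so membership of \<open>Y\<close>
      alone handles all three summands.\<close>
    have "Y + rot Y + rot (rot Y) \<in> range d_total"
      by (intro cvec.subspace_add[OF subspace_range_d_total] rot_range_d_total Y)
    from cvec.subspace_add[OF subspace_range_d_total bullet this]
    show "conformal_ybe ?pr (r\<^sub>T - tensor_flip r\<^sub>T)"
      by (simp only: conformal_ybe_def diff_add_cancel)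
  qed
  also have "\<dots> \<longleftrightarrow> o_operator pr l\<^sub>A r\<^sub>A T0"
    by (simp only: o_operator_def T0_hom eval_Y diff_diff_eq right_minus_eq simp_thms)
  finally show ?thesis
    by (simp only: antisymmetric_diff_flip T0_def[abs_def] simp_thms)
qed

end
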